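(* There is a lower semicomputable chronological contextual semimeasure $\nu$ such that AINU is $\Pi^0_2$-hard; that is, for the $\nu$-optimal policy $\pi^*_\nu$ that breaks ties in favor of the action $\alpha$, the set $\{(h,a):\pi^*_\nu(h)=a\}$ is $\Pi^0_2$-hard.
   Context: The action set is $\mathcal{A}=\{\alpha,\beta\}$, and the percept set is $\mathcal{E}=\{0,1\}\times\{0,1\}$, a percept $e=(o,r)$ consisting of a binary observation $o$ and a binary reward $r$. A history is $\ae_{<t}=a_1e_1\ldots a_{t-1}e_{t-1}\in(\mathcal{A}\times\mathcal{E})^*$. Policies are deterministic maps from histories to actions, identified with their graphs, encoded computably as sets of natural numbers. A set $A\subseteq\mathbb{N}$ is $\Pi^0_2$-hard if every $\Pi^0_2$ set is many-one reducible to $A$. A chronological contextual semimeasure $\nu$ assigns to all equal-length $e_{1:t}\in\mathcal{E}^t$, $a_{1:t}\in\mathcal{A}^t$ a number $\nu(e_{1:t}\,\|\,a_{1:t})\in[0,1]$ with $\nu(\epsilon\,\|\,\epsilon)\le1$ and $\sum_{e_t\in\mathcal{E}}\nu(e_{1:t}\,\|\,a_{1:t})\le\nu(e_{<t}\,\|\,a_{<t})$; it is lower semicomputable if $\{(e_{1:t},a_{1:t},q):q\in\mathbb{Q},\ \nu(e_{1:t}\,\|\,a_{1:t})>q\}$ is recursively enumerable. The discount function $\gamma:\mathbb{N}\to\mathbb{R}_{\ge0}$ is computable and summable with $\Gamma_t:=\sum_{k\ge t}\gamma_k>0$ for all $t$. The value of $\pi$ in $\nu$ after a history with $\nu(e_{<t}\,\|\,a_{<t})>0$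 is $$V^\pi_\nu(\ae_{<t})=\frac1{\Gamma_t}\sum_{k=t}^\infty\gamma_k\sum_{e_{t:k}}r_k\,\frac{\nu(e_{1:k}\,\|\,a_{1:k})}{\nu(e_{<t}\,\|\,a_{<t})},\qquad a_i:=\pi(\ae_{<i})\text{ for }i\ge t;$$ $V^\pi_\nu(\ae_{<t}a)$ is the same expression with $a_t:=a$ (and $\pi$ used afterwards), and $V^*_\nu(\cdot):=\sup_\pi V^\pi_\nu(\cdot)$. AINU is the $\nu$-optimal policy; with ties broken in favor of $\alpha$ it satisfies $\pi^*_\nu(h)=\alpha$ iff $V^*_\nu(h\alpha)\ge V^*_\nu(h\beta)$. *)

theory Defs
  imports "HOL-Analysis.Analysis" "HOL-Library.Nat_Bijection"
begin

section \<open>Partial recursive functions and many-one reducibility\<close>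

text \<open>
  Codes of the mu-recursive functions. Arities are not part of the code: \<open>rec_eval c xs y\<close>
  says that the function denoted by \<open>c\<close> is defined on the argument tuple \<open>xs\<close>, with value \<open>y\<close>.
  On tuples of a fixed length every code denotes a partial recursive function (undefined where a
  projection index is out of range), and all partial recursive functions arise.
\<close>

datatype recf = Zero | Succ | Proj nat | Comp recf "recf list" | Prim recf recf | Mu recf

inductive rec_eval :: "recf \<Rightarrow> nat list \<Rightarrow> nat \<Rightarrow> bool" where
  "rec_eval Zero xs 0"
| "rec_eval Succ (x # xs) (Suc x)"
| "i < length xs \<Longrightarrow> rec_eval (Proj i) xs (xs ! i)"
| "list_all2 (\<lambda>g y. rec_eval g xs y) gs ys \<Longrightarrow> rec_eval f ys z \<Longrightarrow> rec_eval (Comp f gs) xs z"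
| "rec_eval f xs y \<Longrightarrow> rec_eval (Prim f g) (0 # xs) y"
| "rec_eval (Prim f g) (n # xs) y \<Longrightarrow> rec_eval g (n # y # xs) z \<Longrightarrow>
     rec_eval (Prim f g) (Suc n # xs) z"
| "\<forall>i<n. \<exists>y. rec_eval f (i # xs) (Suc y) \<Longrightarrow> rec_eval f (n # xs) 0 \<Longrightarrow> rec_eval (Mu f) xs n"

definition computable :: "(nat \<Rightarrow> nat) \<Rightarrow> bool" where
  "computable f \<longleftrightarrow> (\<exists>c. \<forall>n. rec_eval c [n] (f n))"

definition rec_enumerable :: "nat set \<Rightarrow> bool" where
  "rec_enumerable A \<longleftrightarrow> (\<exists>c. \<forall>n. n \<in> A \<longleftrightarrow> (\<exists>y. rec_eval c [n] y))"

definition decidable3 :: "(nat \<Rightarrow> nat \<Rightarrow> nat \<Rightarrow> bool) \<Rightarrow> bool" where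
  "decidable3 R \<longleftrightarrow> (\<exists>c. \<forall>n x y. rec_eval c [n, x, y] (of_bool (R n x y)))"

definition Pi02 :: "nat set \<Rightarrow> bool" where
  "Pi02 A \<longleftrightarrow> (\<exists>R. decidable3 R \<and> A = {n. \<forall>x. \<exists>y. R n x y})"

definition many_one_reducible :: "nat set \<Rightarrow> nat set \<Rightarrow> bool" where
  "many_one_reducible A B \<longleftrightarrow> (\<exists>f. computable f \<and> (\<forall>n. n \<in> A \<longleftrightarrow> f n \<in> B))"

definition Pi02_hard :: "nat set \<Rightarrow> bool" where
  "Pi02_hard B \<longleftrightarrow> (\<forall>A. Pi02 A \<longrightarrow> many_one_reducible A B)"


section \<open>Histories, policies and their encodings\<close>

datatype action = Alpha | Beta

text \<open>A percept is a pair of a binary observation and a binary reward.\<close>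

type_synonym percept = "bool \<times> bool"
type_synonym history = "(action \<times> percept) list"
type_synonym policy = "history \<Rightarrow> action"

definition reward :: "percept \<Rightarrow> real" where
  "reward e = of_bool (snd e)"

fun action_code :: "action \<Rightarrow> nat" where
  "action_code Alpha = 0"
| "action_code Beta = 1"

definition percept_code :: "percept \<Rightarrow> nat" where
  "percept_code e = prod_encode (of_bool (fst e), of_bool (snd e))"

definition history_code :: "history \<Rightarrow> nat" where
  "history_code h = list_encode (map (\<lambda>(a, e). prod_encode (action_code a, percept_code e)) h)"

definition policy_graph :: "policy \<Rightarrow> nat set" where
  "policy_graph \<pi> = {prod_encode (history_code h, action_code a) | h a. \<pi> h = a}"


section \<open>Semicomputable real-valued functions and environments\<close>

text \<open>
  A rational \<open>q\<close> is coded by any fraction \<open>i / (d + 1)\<close> representing it. As equality of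
  fractions is decidable, it does not matter for recursive enumerability whether all fractions
  or only reduced ones are admitted.
\<close>

definition fraction :: "int \<Rightarrow> nat \<Rightarrow> rat" where
  "fraction i d = of_int i / of_nat (Suc d)"

definition fraction_code :: "int \<Rightarrow> nat \<Rightarrow> nat" where
  "fraction_code i d = prod_encode (int_encode i, d)"

definition computable_real_seq :: "(nat \<Rightarrow> real) \<Rightarrow> bool" where
  "computable_real_seq f \<longleftrightarrow>
     rec_enumerable {prod_encode (n, fraction_code i d) | n i d. f n > of_rat (fraction i d)} \<and>
     rec_enumerable {prod_encode (n, fraction_code i d) | n i d. f n < of_rat (fraction i d)}"

text \<open>
  \<open>\<nu> es as\<close> stands for \<open>\<nu>(es || as)\<close>. It is meaningful only for lists of equal length; its
  values on other arguments are unconstrained and never used.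
\<close>

type_synonym environment = "percept list \<Rightarrow> action list \<Rightarrow> real"

definition chronological_contextual_semimeasure :: "environment \<Rightarrow> bool" where
  "chronological_contextual_semimeasure \<nu> \<longleftrightarrow>
     (\<forall>es as. length es = length as \<longrightarrow> 0 \<le> \<nu> es as \<and> \<nu> es as \<le> 1) \<and>
     \<nu> [] [] \<le> 1 \<and>
     (\<forall>es as a. length es = length as \<longrightarrow> (\<Sum>e\<in>UNIV. \<nu> (es @ [e]) (as @ [a])) \<le> \<nu> es as)"

definition lower_semicomputable :: "environment \<Rightarrow> bool" where
  "lower_semicomputable \<nu> \<longleftrightarrow>
     rec_enumerable {prod_encode (list_encode (map percept_code es),
                       prod_encode (list_encode (map action_code as), fraction_code i d))
                     | es as i d. length es = length as \<and> \<nu> es as > of_rat (fraction i d)}"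

definition env_hist :: "environment \<Rightarrow> history \<Rightarrow> real" where
  "env_hist \<nu> h = \<nu> (map snd h) (map fst h)"


section \<open>Values and optimal policies\<close>

definition discount_tail :: "(nat \<Rightarrow> real) \<Rightarrow> nat \<Rightarrow> real" where
  "discount_tail \<gamma> t = (\<Sum>j. \<gamma> (t + j))"

text \<open>\<open>extend \<pi> h es\<close> continues \<open>h\<close> by the percepts \<open>es\<close>, all actions being chosen by \<open>\<pi>\<close>.\<close>

fun extend :: "policy \<Rightarrow> history \<Rightarrow> percept list \<Rightarrow> history" where
  "extend \<pi> h [] = h"
| "extend \<pi> h (e # es) = extend \<pi> (h @ [(\<pi> h, e)]) es"

text \<open>
  Time starts at 1, so the time step following the history \<open>h\<close> is \<open>t = length h + 1\<close>.
  The outer sum over \<open>k \<ge> t\<close> is written with \<open>k = t + j\<close>, so that the percepts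
  \<open>e\<^sub>t, \<dots>, e\<^sub>k\<close> form a list of length \<open>j + 1\<close>.
\<close>

definition val :: "(nat \<Rightarrow> real) \<Rightarrow> environment \<Rightarrow> policy \<Rightarrow> history \<Rightarrow> real" where
  "val \<gamma> \<nu> \<pi> h =
     (let t = length h + 1 in
      1 / discount_tail \<gamma> t *
      (\<Sum>j. \<gamma> (t + j) *
        (\<Sum>es | length es = Suc j.
           reward (last es) * (env_hist \<nu> (extend \<pi> h es) / env_hist \<nu> h))))"

text \<open>
  The history \<open>h\<close> is met only at the first step of a continuation of \<open>h\<close>; hence overriding
  the policy at \<open>h\<close> replaces exactly the first action by \<open>a\<close>.
\<close>

definition act_val ::
    "(nat \<Rightarrow> real) \<Rightarrow> environment \<Rightarrow> policy \<Rightarrow> history \<Rightarrow> action \<Rightarrow> real" where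
  "act_val \<gamma> \<nu> \<pi> h a = val \<gamma> \<nu> (\<pi>(h := a)) h"

definition opt_val :: "(nat \<Rightarrow> real) \<Rightarrow> environment \<Rightarrow> history \<Rightarrow> real" where
  "opt_val \<gamma> \<nu> h = (SUP \<pi>. val \<gamma> \<nu> \<pi> h)"

definition opt_act_val :: "(nat \<Rightarrow> real) \<Rightarrow> environment \<Rightarrow> history \<Rightarrow> action \<Rightarrow> real" where
  "opt_act_val \<gamma> \<nu> h a = (SUP \<pi>. act_val \<gamma> \<nu> \<pi> h a)"

text \<open>
  Values are defined only after histories of positive \<open>\<nu>\<close>-probability. After other histories
  nothing is required of an optimal policy.
\<close>

definition optimal_policy :: "(nat \<Rightarrow> real) \<Rightarrow> environment \<Rightarrow> policy \<Rightarrow> bool" where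
  "optimal_policy \<gamma> \<nu> \<pi> \<longleftrightarrow>
     (\<forall>h. env_hist \<nu> h > 0 \<longrightarrow> val \<gamma> \<nu> \<pi> h = opt_val \<gamma> \<nu> h)"

definition ainu :: "(nat \<Rightarrow> real) \<Rightarrow> environment \<Rightarrow> policy \<Rightarrow> bool" where
  "ainu \<gamma> \<nu> \<pi> \<longleftrightarrow>
     optimal_policy \<gamma> \<nu> \<pi> \<and>
     (\<forall>h. env_hist \<nu> h > 0 \<longrightarrow>
        (\<pi> h = Alpha \<longleftrightarrow> opt_act_val \<gamma> \<nu> h Alpha \<ge> opt_act_val \<gamma> \<nu> h Beta))"

section \<open>Existence of an optimal policy with the prescribed tie-breaking\<close>

text \<open>
  A policy satisfying the tie-breaking condition at every history of positive probability is
  automatically optimal, so policies as in \<open>ainu\<close> exist. They are unique up to their actions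
  after histories of probability 0.
\<close>

lemma sum_length_Suc:
  fixes F :: "percept list \<Rightarrow> real"
  shows "(\<Sum>es | length es = Suc n. F es) = (\<Sum>e\<in>UNIV. \<Sum>es | length es = n. F (e # es))"
proof -
  have "bij_betw (\<lambda>(e, es). e # es) (UNIV \<times> {es :: percept list. length es = n})
          {es. length es = Suc n}"
    by (rule bij_betwI[where g = "\<lambda>es. (hd es, tl es)"]) (auto simp: length_Suc_conv)
  then have "(\<Sum>es | length es = Suc n. F es) =
      (\<Sum>x\<in>UNIV \<times> {es. length es = n}. F ((\<lambda>(e, es). e # es) x))"
    by (rule sum.reindex_bij_betw[symmetric])
  then show ?thesis by (simp add: sum.cartesian_product split_def)
qed

lemma extend_upd_longer:
  "length h < length h' \<Longrightarrow> extend (\<pi>(h := a)) h' es = extend \<pi> h' es"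
  by (induction es arbitrary: h') auto

locale env_discount =
  fixes \<gamma> :: "nat \<Rightarrow> real" and \<nu> :: environment
  assumes ccs: "chronological_contextual_semimeasure \<nu>"
    and nonneg: "\<And>k. \<gamma> k \<ge> 0" and summ: "summable \<gamma>"
    and tail_pos: "\<And>t. discount_tail \<gamma> t > 0"
begin

abbreviation "P \<equiv> env_hist \<nu>"
abbreviation "G \<equiv> discount_tail \<gamma>"

definition R :: "policy \<Rightarrow> history \<Rightarrow> nat \<Rightarrow> real" where
  "R \<pi> h j = (\<Sum>es | length es = Suc j. reward (last es) * P (extend \<pi> h es))"

definition U :: "policy \<Rightarrow> history \<Rightarrow> real" where
  "U \<pi> h = (\<Sum>j. \<gamma> (Suc (length h) + j) * R \<pi> h j)"

lemma P_nonneg: "P h \<ge> 0"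
  using ccs unfolding chronological_contextual_semimeasure_def env_hist_def by simp

lemma P_step: "(\<Sum>e\<in>UNIV. P (h @ [(a, e)])) \<le> P h"
  using ccs unfolding chronological_contextual_semimeasure_def env_hist_def by simp

lemma reward_bounds: "0 \<le> reward e" "reward e \<le> 1"
  by (simp_all add: reward_def)

lemma R_nonneg: "R \<pi> h j \<ge> 0"
  unfolding R_def by (intro sum_nonneg mult_nonneg_nonneg P_nonneg reward_bounds)

lemma R_Suc: "R \<pi> h (Suc j) = (\<Sum>e\<in>UNIV. R \<pi> (h @ [(\<pi> h, e)]) j)"
proof -
  have "R \<pi> h (Suc j) =
      (\<Sum>e\<in>UNIV. \<Sum>es | length es = Suc j. reward (last (e # es)) * P (extend \<pi> h (e # es)))"
    unfolding R_def by (rule sum_length_Suc)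
  also have "\<dots> = (\<Sum>e\<in>UNIV. R \<pi> (h @ [(\<pi> h, e)]) j)"
    unfolding R_def by (intro sum.cong) auto
  finally show ?thesis .
qed

lemma R_0: "R \<pi> h 0 = (\<Sum>e\<in>UNIV. reward e * P (h @ [(\<pi> h, e)]))"
  unfolding R_def by (subst sum_length_Suc) simp

lemma R_le: "R \<pi> h j \<le> P h"
proof (induction j arbitrary: h)
  case 0
  have "R \<pi> h 0 \<le> (\<Sum>e\<in>UNIV. P (h @ [(\<pi> h, e)]))"
    unfolding R_0 by (intro sum_mono mult_left_le_one_le P_nonneg reward_bounds)
  then show ?case using P_step[of h "\<pi> h"] by linarith
next
  case (Suc j)
  have "R \<pi> h (Suc j) \<le> (\<Sum>e\<in>UNIV. P (h @ [(\<pi> h, e)]))"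
    unfolding R_Suc by (intro sum_mono Suc)
  then show ?case using P_step[of h "\<pi> h"] by linarith
qed

lemma summable_shift: "summable (\<lambda>j. \<gamma> (t + j))"
  using summ by (subst add.commute) (rule summable_ignore_initial_segment)

lemma summable_U: "summable (\<lambda>j. \<gamma> (t + j) * R \<pi> h j)"
proof (rule summable_comparison_test'[where N = 0])
  show "summable (\<lambda>j. \<gamma> (t + j) * P h)" by (intro summable_mult2 summable_shift)
  show "norm (\<gamma> (t + n) * R \<pi> h n) \<le> \<gamma> (t + n) * P h" for n
    using nonneg R_nonneg R_le by (simp add: abs_mult mult_left_mono)
qed

lemma U_nonneg: "U \<pi> h \<ge> 0"
  unfolding U_def by (intro suminf_nonneg summable_U mult_nonneg_nonneg nonneg R_nonneg)

lemma U_le: "U \<pi> h \<le> G (Suc (length h)) * P h"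
proof -
  have "U \<pi> h \<le> (\<Sum>j. \<gamma> (Suc (length h) + j) * P h)"
    unfolding U_def
    by (intro suminf_le summable_U summable_mult2 summable_shift mult_left_mono nonneg R_le)
  also have "\<dots> = G (Suc (length h)) * P h"
    unfolding discount_tail_def by (rule suminf_mult2[symmetric, OF summable_shift])
  finally show ?thesis .
qed

lemma U_step:
  "U \<pi> h = \<gamma> (Suc (length h)) * (\<Sum>e\<in>UNIV. reward e * P (h @ [(\<pi> h, e)])) +
            (\<Sum>e\<in>UNIV. U \<pi> (h @ [(\<pi> h, e)]))"
proof -
  have "U \<pi> h = (\<Sum>j. \<gamma> (Suc (length h) + Suc j) * R \<pi> h (Suc j)) + \<gamma> (Suc (length h)) * R \<pi> h 0"
    unfolding U_def using suminf_split_head[OF summable_U[of "Suc (length h)" \<pi> h]] by simp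
  moreover have "(\<Sum>j. \<gamma> (Suc (length h) + Suc j) * R \<pi> h (Suc j)) =
      (\<Sum>j. \<Sum>e\<in>UNIV. \<gamma> (Suc (Suc (length h)) + j) * R \<pi> (h @ [(\<pi> h, e)]) j)"
    by (simp add: R_Suc sum_distrib_left)
  moreover have "\<dots> = (\<Sum>e\<in>UNIV. U \<pi> (h @ [(\<pi> h, e)]))"
    unfolding U_def
    using summable_U[of "Suc (Suc (length h))"] by (subst suminf_sum) simp_all
  ultimately show ?thesis by (simp add: R_0)
qed

lemma U_upd_longer: "length h < length h' \<Longrightarrow> U (\<pi>(h := a)) h' = U \<pi> h'"
  by (simp add: U_def R_def extend_upd_longer)

lemma val_eq: "val \<gamma> \<nu> \<pi> h = U \<pi> h / (G (Suc (length h)) * P h)"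
proof -
  have "val \<gamma> \<nu> \<pi> h = 1 / G (Suc (length h)) *
      (\<Sum>j. \<gamma> (Suc (length h) + j) * R \<pi> h j / P h)"
    by (simp add: val_def R_def sum_divide_distrib[symmetric] Let_def)
  also have "(\<Sum>j. \<gamma> (Suc (length h) + j) * R \<pi> h j / P h) = U \<pi> h / P h"
    unfolding U_def by (rule suminf_divide[OF summable_U])
  finally show ?thesis by simp
qed

lemma val_le_1: "val \<gamma> \<nu> \<pi> h \<le> 1"
  using U_le[of \<pi> h] P_nonneg[of h] tail_pos[of "Suc (length h)"]
  by (auto simp: val_eq divide_le_eq_1 zero_less_mult_iff mult_less_0_iff)

lemma bdd: "bdd_above (range (\<lambda>\<pi>. val \<gamma> \<nu> \<pi> h))" "bdd_above (range (\<lambda>\<pi>. act_val \<gamma> \<nu> \<pi> h a))"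
  using val_le_1 by (auto simp: act_val_def intro!: bdd_aboveI2[where M = 1])

lemma greedy_optimal:
  assumes greedy: "\<And>h a. P h > 0 \<Longrightarrow> opt_act_val \<gamma> \<nu> h a \<le> opt_act_val \<gamma> \<nu> h (g h)"
  shows "optimal_policy \<gamma> \<nu> g"
proof -
  have bound: "U \<pi> h \<le> U g h + G (Suc (length h) + n) * P h" for \<pi> h n
  proof (induction n arbitrary: \<pi> h)
    case 0
    show ?case using U_le[of \<pi> h] U_nonneg[of g h] by simp
  next
    case (Suc n)
    define B where "B = G (Suc (length h) + Suc n) * P h"
    show ?case
    proof (cases "P h > 0")
      case False
      then have "P h = 0" using P_nonneg[of h] by simp
      then show ?thesis using U_le[of \<pi> h] U_nonneg[of g h] by simp
    next
      case True
      define D where "D = G (Suc (length h)) * P h"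
      have D: "D > 0" using True tail_pos by (simp add: D_def)
      have "U (\<pi>'(h := g h)) h \<le> U g h + B" for \<pi>'
      proof -
        have "(\<Sum>e\<in>UNIV. U \<pi>' (h @ [(g h, e)])) \<le>
            (\<Sum>e\<in>UNIV. U g (h @ [(g h, e)]) +
               G (Suc (length h) + Suc n) * P (h @ [(g h, e)]))"
          using Suc.IH[of \<pi>' "h @ [(g h, _)]"] by (intro sum_mono) simp
        also have "\<dots> = (\<Sum>e\<in>UNIV. U g (h @ [(g h, e)])) +
            G (Suc (length h) + Suc n) * (\<Sum>e\<in>UNIV. P (h @ [(g h, e)]))"
          by (simp add: sum.distrib sum_distrib_left)
        also have "\<dots> \<le> (\<Sum>e\<in>UNIV. U g (h @ [(g h, e)])) + B"
          unfolding B_def by (intro add_left_mono mult_left_mono P_step less_imp_le tail_pos)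
        finally show ?thesis
          unfolding U_step[of _ h] by (simp add: U_upd_longer)
      qed
      then have "act_val \<gamma> \<nu> \<pi>' h (g h) \<le> (U g h + B) / D" for \<pi>'
        using D by (simp add: act_val_def val_eq D_def[symmetric] divide_right_mono)
      then have "opt_act_val \<gamma> \<nu> h (g h) \<le> (U g h + B) / D"
        unfolding opt_act_val_def by (intro cSUP_least) auto
      moreover have "act_val \<gamma> \<nu> \<pi> h (\<pi> h) \<le> opt_act_val \<gamma> \<nu> h (\<pi> h)"
        unfolding opt_act_val_def by (rule cSUP_upper[OF UNIV_I bdd(2)])
      ultimately have "val \<gamma> \<nu> \<pi> h \<le> (U g h + B) / D"
        using greedy[OF True, of "\<pi> h"] by (simp add: act_val_def)
      then show ?thesis
        using D by (simp add: val_eq D_def[symmetric] B_def divide_le_cancel)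
    qed
  qed
  have "G \<longlonglongrightarrow> 0"
  proof -
    have "G = (\<lambda>n. suminf \<gamma> - sum \<gamma> {..<n})"
      using suminf_minus_initial_segment[OF summ]
      by (auto simp: discount_tail_def add.commute)
    moreover have "(\<lambda>n. suminf \<gamma> - sum \<gamma> {..<n}) \<longlonglongrightarrow> suminf \<gamma> - suminf \<gamma>"
      by (intro tendsto_intros summable_LIMSEQ summ)
    ultimately show ?thesis by simp
  qed
  then have G_lim: "(\<lambda>n. G (k + n)) \<longlonglongrightarrow> 0" for k
    using LIMSEQ_ignore_initial_segment[of G 0 k] by (simp add: add.commute)
  have U_max: "U \<pi> h \<le> U g h" for \<pi> h
  proof (rule LIMSEQ_le_const)
    show "(\<lambda>n. U g h + G (Suc (length h) + n) * P h) \<longlonglongrightarrow> U g h"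
      by (rule tendsto_eq_rhs[OF tendsto_add[OF tendsto_const tendsto_mult_left_zero[OF G_lim]]]) simp
    show "\<exists>N. \<forall>n\<ge>N. U \<pi> h \<le> U g h + G (Suc (length h) + n) * P h" using bound by blast
  qed
  have "val \<gamma> \<nu> g h = opt_val \<gamma> \<nu> h" for h
  proof (rule antisym)
    show "val \<gamma> \<nu> g h \<le> opt_val \<gamma> \<nu> h"
      unfolding opt_val_def by (rule cSUP_upper[OF UNIV_I bdd(1)])
    show "opt_val \<gamma> \<nu> h \<le> val \<gamma> \<nu> g h"
      unfolding opt_val_def val_eq
      using U_max P_nonneg[of h] tail_pos[of "Suc (length h)"]
      by (intro cSUP_least divide_right_mono) auto
  qed
  then show ?thesis by (simp add: optimal_policy_def)
qed

end

theorem ex_ainu: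
  assumes "chronological_contextual_semimeasure \<nu>"
    and "\<forall>k. \<gamma> k \<ge> 0" and "summable \<gamma>" and "\<forall>t. discount_tail \<gamma> t > 0"
  shows "\<exists>\<pi>. ainu \<gamma> \<nu> \<pi>"
proof -
  interpret env_discount \<gamma> \<nu> using assms by unfold_locales auto
  define g where
    "g h = (if opt_act_val \<gamma> \<nu> h Alpha \<ge> opt_act_val \<gamma> \<nu> h Beta then Alpha else Beta)" for h
  have "opt_act_val \<gamma> \<nu> h a \<le> opt_act_val \<gamma> \<nu> h (g h)" for h a
    by (cases a) (auto simp: g_def)
  then have "optimal_policy \<gamma> \<nu> g" by (rule greedy_optimal)
  then have "ainu \<gamma> \<nu> g" by (auto simp: ainu_def g_def)
  then show ?thesis by (intro exI[where x = g])
qed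

end

theory Submission
  imports Defs
begin

text \<open>
  The environment always emits the percept \<open>(0, 1)\<close>. After the actions \<open>\<alpha>\<^sup>n \<beta>\<close>, the next action
  \<open>\<beta>\<close> preserves all probability, whereas \<open>\<alpha>\<close> reduces it to
  \<open>p\<^sub>n = sup {m / (m + 1) | m. \<forall>i < m. \<exists>k. W n i k}\<close>. All rewards being 1, these two actions have
  the values 1 and \<open>p\<^sub>n\<close> whatever the discount, so AINU takes \<open>\<alpha>\<close> iff \<open>p\<^sub>n = 1\<close>, that is, iff
  \<open>\<forall>i. \<exists>k. W n i k\<close>. Each lower bound \<open>m / (m + 1)\<close> is verified by finitely many values of \<open>W\<close>,
  which makes the environment lower semicomputable. A decidable \<open>W\<close> that serves every
  \<open>\<Pi>\<^sup>0\<^sub>2\<close> set at once lets \<open>k\<close> range over formal derivations of evaluations of the codes \<open>recf\<close>.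
\<close>

section \<open>Recursive functions and decidable predicates\<close>

lemma rec_eval_deterministic: "rec_eval c xs y \<Longrightarrow> rec_eval c xs y' \<Longrightarrow> y' = y"
proof (induction arbitrary: y' rule: rec_eval.induct)
  case (4 xs gs ys f z)
  from "4.prems" obtain ys' where ys': "list_all2 (\<lambda>g y. rec_eval g xs y) gs ys'" "rec_eval f ys' y'"
    by cases
  have "ys' = ys"
    using "4.IH"(1) ys'(1) by (auto simp: list_all2_conv_all_nth intro!: nth_equalityI)
  then show ?case using "4.IH"(2) ys'(2) by simp
next
  case (7 n f xs)
  from "7.prems" have y': "\<forall>i<y'. \<exists>y. rec_eval f (i # xs) (Suc y)" "rec_eval f (y' # xs) 0"
    by (cases; simp)+
  \<comment> \<open>Of two different results of the same search, the smaller would be an argument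
    where \<open>f\<close> has both the value \<open>0\<close> and a successor value.\<close>
  have "\<not> n < y'" using y'(1) "7.IH"(2) by force
  moreover have "\<not> y' < n" using "7.IH"(1) y'(2) by force
  ultimately show ?case by simp
next
  case (5 f xs y g)
  from "5.prems" show ?case by cases (use "5.IH" in auto)
next
  case (6 f g n xs y z)
  from "6.prems" obtain w where "rec_eval (Prim f g) (n # xs) w" "rec_eval g (n # w # xs) y'"
    by cases auto
  then show ?case using "6.IH" by blast
qed (erule rec_eval.cases; simp; fail)+

text \<open>
  Functions of finitely many of the variables \<open>e 0, e 1, \<dots>\<close>. Every sufficiently long tuple of
  values must be accepted, so no arities have to be tracked, and binding a new variable \<open>e 0\<close>
  shifts the others.
\<close>

definition recursive :: "((nat \<Rightarrow> nat) \<Rightarrow> nat) \<Rightarrow> bool" where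
  "recursive F \<longleftrightarrow> (\<exists>c. \<forall>\<^sub>F k in sequentially. \<forall>e. rec_eval c (map e [0..<k]) (F e))"

definition decidable :: "((nat \<Rightarrow> nat) \<Rightarrow> bool) \<Rightarrow> bool" where
  "decidable P \<longleftrightarrow> recursive (\<lambda>e. of_bool (P e))"

named_theorems recursive_intros

section \<open>Closure under substitution and primitive recursion\<close>

lemma map_case_nat_upt: "map (case_nat x e) [0..<Suc k] = x # map e [0..<k]"
  by (subst upt_conv_Cons) (simp_all add: map_Suc_upt[symmetric] del: upt_Suc)

lemma recursive_var [recursive_intros]: "recursive (\<lambda>e. e i)"
proof -
  have "\<forall>\<^sub>F k in sequentially. \<forall>e. rec_eval (Proj i) (map e [0..<k]) (e i)"
    using eventually_gt_at_top[of i]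
  proof eventually_elim
    case (elim k)
    then show ?case using rec_eval.intros(3)[of i "map e [0..<k]" for e] by simp
  qed
  then show ?thesis unfolding recursive_def by blast
qed

text \<open>A single length \<open>n\<close> accepted by the code of \<open>F\<close> is enough:
  only the first \<open>n\<close> functions \<open>G j\<close> are composed with it, and finitely
  many of them share a threshold for the tuple length.\<close>

lemma recursive_subst:
  assumes "recursive F" and "\<And>j. recursive (G j)"
  shows "recursive (\<lambda>e. F (\<lambda>j. G j e))"
proof -
  obtain c n where c: "\<And>e. rec_eval c (map e [0..<n]) (F e)"
    using assms(1) by (auto simp: recursive_def eventually_sequentially)
  have "\<forall>j. \<exists>c. \<forall>\<^sub>F k in sequentially. \<forall>e. rec_eval c (map e [0..<k]) (G j e)"
    using assms(2) unfolding recursive_def by blast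
  from choice[OF this] obtain d where
    d: "\<And>j. \<forall>\<^sub>F k in sequentially. \<forall>e. rec_eval (d j) (map e [0..<k]) (G j e)"
    by blast
  have "\<forall>\<^sub>F k in sequentially. \<forall>j\<in>{..<n}. \<forall>e. rec_eval (d j) (map e [0..<k]) (G j e)"
    using d by (intro eventually_ball_finite) auto
  then have "\<forall>\<^sub>F k in sequentially. \<forall>e.
      rec_eval (Comp c (map d [0..<n])) (map e [0..<k]) (F (\<lambda>j. G j e))"
  proof eventually_elim
    case (elim k)
    then show ?case
      by (intro allI rec_eval.intros(4)[OF _ c]) (auto simp: list_all2_conv_all_nth)
  qed
  then show ?thesis unfolding recursive_def by blast
qed

lemma recursive_comp1:
  "recursive (\<lambda>e. f (e 0)) \<Longrightarrow> recursive g \<Longrightarrow> recursive (\<lambda>e. f (g e))"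
  using recursive_subst[of "\<lambda>e. f (e 0)" "\<lambda>_. g"] by simp

lemma recursive_comp2:
  assumes "recursive (\<lambda>e. f (e 0) (e (Suc 0)))" "recursive g" "recursive h"
  shows "recursive (\<lambda>e. f (g e) (h e))"
  using recursive_subst[OF assms(1), of "case_nat g (\<lambda>_. h)"] assms(2,3)
  by (simp split: nat.split)

lemma recursive_0: "recursive (\<lambda>e. 0)"
  unfolding recursive_def by (intro exI[of _ Zero] always_eventually allI rec_eval.intros)

lemma recursive_Suc [recursive_intros]: "recursive g \<Longrightarrow> recursive (\<lambda>e. Suc (g e))"
proof (rule recursive_comp1[of Suc])
  have "\<forall>\<^sub>F k in sequentially. \<forall>e. rec_eval Succ (map e [0..<k]) (Suc (e 0))"
    using eventually_gt_at_top[of 0]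
    by eventually_elim (auto simp: upt_conv_Cons intro: rec_eval.intros)
  then show "recursive (\<lambda>e. Suc (e 0))" unfolding recursive_def by blast
qed

lemma recursive_const [recursive_intros]: "recursive (\<lambda>e. n)"
  by (induction n) (auto intro: recursive_0 recursive_Suc)

text \<open>\<open>Prim\<close> takes the counter as its first argument. So the counter is first
  kept in variable 0, with the parameters shifted up by one, and \<open>m\<close> is substituted for
  it at the end.\<close>

lemma recursive_rec_nat [recursive_intros]:
  assumes a: "recursive a" and s: "recursive (\<lambda>e. s (\<lambda>j. e (Suc (Suc j))) (e 0) (e (Suc 0)))"
    and m: "recursive m"
  shows "recursive (\<lambda>e. rec_nat (a e) (s e) (m e))"
proof -
  obtain c where c: "\<forall>\<^sub>F k in sequentially. \<forall>e. rec_eval c (map e [0..<k]) (a e)"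
    using a by (auto simp: recursive_def)
  obtain d n where d: "\<And>k e. k \<ge> n \<Longrightarrow>
      rec_eval d (map e [0..<k]) (s (\<lambda>j. e (Suc (Suc j))) (e 0) (e (Suc 0)))"
    using s by (auto simp: recursive_def eventually_sequentially)
  have "\<forall>\<^sub>F k in sequentially. \<forall>e. rec_eval (Prim c d) (e 0 # map (\<lambda>j. e (Suc j)) [0..<k])
      (rec_nat (a (\<lambda>j. e (Suc j))) (s (\<lambda>j. e (Suc j))) (e 0))"
    using c eventually_ge_at_top[of n]
  proof eventually_elim
    case (elim k)
    have "rec_eval (Prim c d) (i # map e [0..<k]) (rec_nat (a e) (s e) i)" for i e
    proof (induction i)
      case 0
      show ?case using elim(1) by (auto intro: rec_eval.intros)
    next
      case (Suc i)
      let ?y = "rec_nat (a e) (s e) i"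
      \<comment> \<open>\<open>case_nat\<close> pushes the previous value and then the counter onto
        the assignment; as a tuple this is consing, in the argument order of
        \<open>Prim\<close>.\<close>
      have "rec_eval d (i # ?y # map e [0..<k]) (s e i ?y)"
        using d[of "Suc (Suc k)" "case_nat i (case_nat ?y e)"] elim(2)
        by (simp add: map_case_nat_upt del: upt_Suc)
      with Suc show ?case by (auto intro: rec_eval.intros)
    qed
    then show ?case by blast
  qed
  then have "\<forall>\<^sub>F k in sequentially. \<forall>e. rec_eval (Prim c d) (map e [0..<Suc k])
      (rec_nat (a (\<lambda>j. e (Suc j))) (s (\<lambda>j. e (Suc j))) (e 0))"
    by (rule eventually_mono) (auto simp: upt_conv_Cons map_Suc_upt[symmetric] comp_def simp del: upt_Suc)
  then have "recursive (\<lambda>e. rec_nat (a (\<lambda>j. e (Suc j))) (s (\<lambda>j. e (Suc j))) (e 0))"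
    unfolding recursive_def by (subst (asm) eventually_sequentially_Suc) blast
  from recursive_subst[OF this, of "case_nat m (\<lambda>j e. e j)"] show ?thesis
    by (simp add: m recursive_var split: nat.split)
qed

section \<open>Arithmetic and bounded quantification\<close>

lemma recursive_add [recursive_intros]:
  assumes "recursive f" "recursive g"
  shows "recursive (\<lambda>e. f e + g e)"
proof -
  have *: "m + n = rec_nat m (\<lambda>_. Suc) n" for m n :: nat by (induction n) auto
  show ?thesis unfolding * by (intro recursive_rec_nat recursive_Suc recursive_var assms)
qed

lemma recursive_mult [recursive_intros]:
  assumes "recursive f" "recursive g"
  shows "recursive (\<lambda>e. f e * g e)"
proof -
  have *: "m * n = rec_nat 0 (\<lambda>_ y. m + y) n" for m n :: nat by (induction n) auto
  show ?thesis unfolding *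
    by (rule recursive_comp2[OF _ assms], intro recursive_rec_nat recursive_add recursive_var recursive_0)
qed

lemma recursive_pred:
  assumes "recursive f"
  shows "recursive (\<lambda>e. f e - Suc 0)"
proof -
  have *: "n - Suc 0 = rec_nat 0 (\<lambda>k _. k) n" for n :: nat by (induction n) auto
  show ?thesis unfolding * by (intro recursive_rec_nat recursive_0 recursive_var assms)
qed

lemma recursive_diff [recursive_intros]:
  assumes "recursive f" "recursive g"
  shows "recursive (\<lambda>e. f e - g e)"
proof -
  have "m - n = rec_nat m (\<lambda>_ y. y - Suc 0) n" for m n :: nat
    by (induction n) (simp, simp only: old.nat.simps diff_Suc_eq_diff_pred diff_commute)
  then have *: "rec_nat (f e) (\<lambda>_ y. y - Suc 0) (g e) = f e - g e" for e by (rule sym)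
  have "recursive (\<lambda>e. rec_nat (f e) (\<lambda>_ y. y - Suc 0) (g e))"
    by (intro recursive_rec_nat recursive_pred recursive_var assms)
  then show ?thesis by (simp only: *)
qed

lemma decidable_eq_0:
  assumes "recursive f"
  shows "decidable (\<lambda>e. f e = 0)"
proof -
  have *: "of_bool (n = 0) = 1 - n" for n :: nat by (cases n) auto
  show ?thesis unfolding decidable_def * by (intro recursive_diff recursive_const assms)
qed

lemma decidable_not [recursive_intros]: "decidable P \<Longrightarrow> decidable (\<lambda>e. \<not> P e)"
  using decidable_eq_0[of "\<lambda>e. of_bool (P e)"] by (simp add: decidable_def)

lemma decidable_and [recursive_intros]:
  "decidable P \<Longrightarrow> decidable Q \<Longrightarrow> decidable (\<lambda>e. P e \<and> Q e)"
  by (simp add: decidable_def of_bool_conj recursive_mult)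

lemma decidable_or [recursive_intros]:
  "decidable P \<Longrightarrow> decidable Q \<Longrightarrow> decidable (\<lambda>e. P e \<or> Q e)"
  using decidable_not[OF decidable_and[OF decidable_not[of P] decidable_not[of Q]]] by simp

lemma decidable_le [recursive_intros]:
  "recursive f \<Longrightarrow> recursive g \<Longrightarrow> decidable (\<lambda>e. f e \<le> g e)"
  using decidable_eq_0[OF recursive_diff[of f g]] by simp

lemma decidable_less [recursive_intros]:
  "recursive f \<Longrightarrow> recursive g \<Longrightarrow> decidable (\<lambda>e. f e < g e)"
  using decidable_not[OF decidable_le[of g f]] by (simp add: not_le)

lemma decidable_eq [recursive_intros]:
  "recursive f \<Longrightarrow> recursive g \<Longrightarrow> decidable (\<lambda>e. f e = g e)"
  using decidable_and[OF decidable_le[of f g] decidable_le[of g f]] by (simp add: order_eq_iff)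

lemma decidable_subst:
  "decidable P \<Longrightarrow> (\<And>j. recursive (G j)) \<Longrightarrow> decidable (\<lambda>e. P (\<lambda>j. G j e))"
  unfolding decidable_def by (rule recursive_subst)

text \<open>A bounded universal quantifier is a product of truth values, computed by recursion on
  the bound.\<close>

lemma decidable_all [recursive_intros]:
  assumes P: "decidable (\<lambda>e. P (\<lambda>j. e (Suc j)) (e 0))" and f: "recursive f"
  shows "decidable (\<lambda>e. \<forall>i<f e. P e i)"
proof -
  have *: "of_bool (\<forall>i<n. P e i) = (rec_nat 1 (\<lambda>i y. y * of_bool (P e i)) n :: nat)" for e n
    by (induction n) (simp_all add: All_less_Suc of_bool_conj mult.commute)
  \<comment> \<open>In the step of the recursion, variable 1 holds the product so far and has to be
    skipped by \<open>P\<close>.\<close>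
  have "decidable (\<lambda>e. P (\<lambda>j. e (Suc (Suc j))) (e 0))"
    using decidable_subst[OF P, of "case_nat (\<lambda>e. e 0) (\<lambda>j e. e (Suc (Suc j)))"]
    by (simp add: recursive_var split: nat.split)
  then show ?thesis unfolding decidable_def *
    by (intro recursive_rec_nat recursive_mult recursive_const recursive_var f)
qed

lemma decidable_ex [recursive_intros]:
  assumes "decidable (\<lambda>e. P (\<lambda>j. e (Suc j)) (e 0))" and "recursive f"
  shows "decidable (\<lambda>e. \<exists>i<f e. P e i)"
  using decidable_not[OF decidable_all[OF decidable_not[OF assms(1)] assms(2)]] by simp

section \<open>Unbounded search and transfer to fixed arities\<close>

lemma recursive_Least:
  assumes P: "decidable (\<lambda>e. P (\<lambda>j. e (Suc j)) (e 0))" and ex: "\<And>e. \<exists>k. P e k"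
  shows "recursive (\<lambda>e. LEAST k. P e k)"
proof -
  \<comment> \<open>\<open>Mu\<close> stops at the value \<open>0\<close>, so it is run on the truth
    value of the negation.\<close>
  obtain c where c: "\<forall>\<^sub>F k in sequentially. \<forall>e. rec_eval c (map e [0..<k])
      (of_bool (\<not> P (\<lambda>j. e (Suc j)) (e 0)))"
    using decidable_not[OF P] by (auto simp: recursive_def decidable_def)
  have "\<forall>\<^sub>F k in sequentially. \<forall>e. rec_eval (Mu c) (map e [0..<k]) (LEAST k. P e k)"
    \<comment> \<open>The search variable lengthens the tuple by one, which shifts the
      threshold.\<close>
    using c[folded eventually_sequentially_Suc[of "\<lambda>k. \<forall>e. rec_eval c (map e [0..<k]) (F e)" for F]]
  proof eventually_elim
    case (elim k)
    have *: "rec_eval c (i # map e [0..<k]) (of_bool (\<not> P e i))" for i e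
      using elim[rule_format, of "case_nat i e"] by (simp add: map_case_nat_upt del: upt_Suc)
    show ?case
    proof
      fix e
      show "rec_eval (Mu c) (map e [0..<k]) (LEAST k. P e k)"
      proof (rule rec_eval.intros(7))
        show "\<forall>i<LEAST k. P e k. \<exists>y. rec_eval c (i # map e [0..<k]) (Suc y)"
          using *[of _ e] not_less_Least[of _ "P e"] by (metis One_nat_def of_bool_eq(2))
        show "rec_eval c ((LEAST k. P e k) # map e [0..<k]) 0"
          using *[of "LEAST k. P e k" e] LeastI_ex[OF ex[of e]] by simp
      qed
    qed
  qed
  then show ?thesis unfolding recursive_def by blast
qed

text \<open>A projection of a decidable relation is the domain of the search for a witness.\<close>

lemma rec_enumerableI:
  assumes "decidable (\<lambda>e. P (e (Suc 0)) (e 0))" and A: "\<And>n. n \<in> A \<longleftrightarrow> (\<exists>k. P n k)"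
  shows "rec_enumerable A"
proof -
  have "recursive (\<lambda>e. of_bool (\<not> P (e (Suc 0)) (e 0)))"
    using decidable_not[OF assms(1)] by (simp add: decidable_def)
  then obtain c k where c: "\<And>e. rec_eval c (map e [0..<k]) (of_bool (\<not> P (e (Suc 0)) (e 0)))"
    by (auto simp: recursive_def eventually_sequentially)
  \<comment> \<open>The code \<open>c\<close> is known to accept tuples of one length
    \<open>k\<close>; \<open>d\<close> turns the pair \<open>[i, n]\<close> into such a tuple, with
    zeros after the first two entries.\<close>
  define d where "d = Comp c (map (\<lambda>i. if i < 2 then Proj i else Zero) [0..<k])"
  have d: "rec_eval d [i, n] (of_bool (\<not> P n i))" for i n
    unfolding d_def using c[of "\<lambda>j. if j = 0 then i else if j = 1 then n else 0"]
    by (intro rec_eval.intros(4)[where ys = "map (\<lambda>j. if j = 0 then i else if j = 1 then n else 0) [0..<k]"])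
       (auto simp: list_all2_conv_all_nth less_2_cases_iff intro: rec_eval.intros(1)
         rec_eval.intros(3)[of 0 "[i, n]", simplified] rec_eval.intros(3)[of 1 "[i, n]", simplified])
  have "(\<exists>y. rec_eval (Mu d) [n] y) \<longleftrightarrow> (\<exists>k. P n k)" for n
  proof
    assume "\<exists>y. rec_eval (Mu d) [n] y"
    then obtain y where "rec_eval (Mu d) [n] y" ..
    then have "rec_eval d [y, n] 0" by cases simp
    with d[of y n] have "of_bool (\<not> P n y) = (0 :: nat)" by (metis rec_eval_deterministic)
    then show "\<exists>k. P n k" by auto
  next
    assume ex: "\<exists>k. P n k"
    have "rec_eval (Mu d) [n] (LEAST k. P n k)"
    proof (rule rec_eval.intros(7))
      show "\<forall>i<LEAST k. P n k. \<exists>y. rec_eval d (i # [n]) (Suc y)"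
        using d[of _ n] not_less_Least[of _ "P n"] by (metis One_nat_def of_bool_eq(2))
      show "rec_eval d ((LEAST k. P n k) # [n]) 0"
        using d[of "LEAST k. P n k" n] LeastI_ex[OF ex] by simp
    qed
    then show "\<exists>y. rec_eval (Mu d) [n] y" ..
  qed
  then show ?thesis unfolding rec_enumerable_def using A by blast
qed

lemma computableI:
  assumes "recursive (\<lambda>e. f (e 0))"
  shows "computable f"
proof -
  obtain c k where c: "\<And>e. rec_eval c (map e [0..<k]) (f (e 0))"
    using assms by (auto simp: recursive_def eventually_sequentially)
  have "rec_eval (Comp c (map (\<lambda>i. if i = 0 then Proj 0 else Zero) [0..<k])) [n] (f n)" for n
    using c[of "\<lambda>j. if j = 0 then n else 0"]
    by (intro rec_eval.intros(4)[where ys = "map (\<lambda>j. if j = 0 then n else 0) [0..<k]"])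
       (auto simp: list_all2_conv_all_nth intro: rec_eval.intros(1)
         rec_eval.intros(3)[of 0 "[n]", simplified])
  then show ?thesis unfolding computable_def by blast
qed

section \<open>Pairs and lists coded by numbers\<close>

lemma recursive_prod_encode [recursive_intros]:
  assumes "recursive f" "recursive g"
  shows "recursive (\<lambda>e. prod_encode (f e, g e))"
proof -
  have *: "triangle n = rec_nat 0 (\<lambda>k y. y + Suc k) n" for n by (induction n) auto
  show ?thesis
    unfolding prod_encode_def prod.case * by (intro recursive_intros assms)
qed

text \<open>Both components of a pair are at most its code. Decoding is thus a search that always
  succeeds and whose inner quantifier is bounded.\<close>

lemma prod_decode_eq_Least:
  "fst (prod_decode z) = (LEAST a. \<exists>b<Suc z. prod_encode (a, b) = z)"
  "snd (prod_decode z) = (LEAST b. \<exists>a<Suc z. prod_encode (a, b) = z)"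
proof -
  obtain x y where z: "z = prod_encode (x, y)" by (metis prod_decode_inverse surj_pair)
  show "fst (prod_decode z) = (LEAST a. \<exists>b<Suc z. prod_encode (a, b) = z)"
    "snd (prod_decode z) = (LEAST b. \<exists>a<Suc z. prod_encode (a, b) = z)"
    using le_prod_encode_1[of x y] le_prod_encode_2[of y x]
    by (auto simp: z less_Suc_eq_le intro!: Least_equality[symmetric])
qed

lemma recursive_fst_snd [recursive_intros]:
  assumes "recursive f"
  shows "recursive (\<lambda>e. fst (prod_decode (f e)))" "recursive (\<lambda>e. snd (prod_decode (f e)))"
proof -
  have ex: "\<exists>a. \<exists>b<Suc z. prod_encode (a, b) = z" "\<exists>b. \<exists>a<Suc z. prod_encode (a, b) = z" for z
    by (metis le_prod_encode_1 le_prod_encode_2 less_Suc_eq_le prod_decode_inverse surj_pair)+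
  show "recursive (\<lambda>e. fst (prod_decode (f e)))"
    unfolding prod_decode_eq_Least
    by (rule recursive_comp1[OF _ assms], intro recursive_Least ex recursive_intros)
  show "recursive (\<lambda>e. snd (prod_decode (f e)))"
    unfolding prod_decode_eq_Least
    by (rule recursive_comp1[OF _ assms], intro recursive_Least ex recursive_intros)
qed

abbreviation "pfst z \<equiv> fst (prod_decode z)"
abbreviation "psnd z \<equiv> snd (prod_decode z)"

text \<open>A nonempty list is coded by the successor of the pair of its head and its coded tail, so
  the head is \<open>pfst\<close> of the predecessor. Out of range the result is
  \<open>0\<close>.\<close>

definition list_nth :: "nat \<Rightarrow> nat \<Rightarrow> nat" where
  "list_nth z i = pfst (list_encode (drop i (list_decode z)) - 1)"

lemma list_encode_eq_0_iff: "list_encode xs = 0 \<longleftrightarrow> xs = []"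
  by (cases xs) auto

text \<open>The empty list is included: its code is \<open>0\<close>, and \<open>0 - 1 = 0\<close>
  decodes to a pair of zeros.\<close>

lemma list_encode_tl: "list_encode (tl (list_decode z)) = psnd (z - 1)"
  using prod_encode_inverse[of "(0, 0)"] by (cases z) (auto simp: prod_encode_def split: prod.split)

lemma list_nth: "i < length (list_decode z) \<Longrightarrow> list_nth z i = list_decode z ! i"
  by (simp add: list_nth_def Cons_nth_drop_Suc[symmetric])

lemma recursive_drop [recursive_intros]:
  assumes "recursive f" "recursive g"
  shows "recursive (\<lambda>e. list_encode (drop (g e) (list_decode (f e))))"
proof -
  have *: "list_encode (drop n (list_decode z)) = rec_nat z (\<lambda>_ y. psnd (y - 1)) n" for n z
  proof (induction n)
    case (Suc n)
    have "list_encode (drop (Suc n) (list_decode z)) =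
        list_encode (tl (list_decode (list_encode (drop n (list_decode z)))))"
      by (simp add: drop_Suc tl_drop)
    then show ?case by (simp only: list_encode_tl Suc old.nat.simps)
  qed simp
  show ?thesis unfolding * by (intro recursive_intros assms)
qed

lemma recursive_list_nth [recursive_intros]:
  "recursive f \<Longrightarrow> recursive g \<Longrightarrow> recursive (\<lambda>e. list_nth (f e) (g e))"
  unfolding list_nth_def by (intro recursive_intros)

lemma recursive_length [recursive_intros]:
  assumes "recursive f"
  shows "recursive (\<lambda>e. length (list_decode (f e)))"
proof -
  have *: "length (list_decode z) = (LEAST i. list_encode (drop i (list_decode z)) = 0)" for z
    by (rule Least_equality[symmetric]) (auto simp: list_encode_eq_0_iff)
  have ex: "\<exists>i. list_encode (drop i (list_decode z)) = 0" for z
    by (rule exI[of _ "length (list_decode z)"]) simp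
  show ?thesis
    unfolding * by (rule recursive_comp1[OF _ assms], intro recursive_Least ex recursive_intros)
qed

text \<open>Serves the two families of lists that begin with a variable number of \<alpha>: the
  histories \<open>decision_point n\<close> and the action lists coded by
  \<open>switch_code n r\<close>.\<close>

lemma recursive_replicate_append [recursive_intros]:
  assumes "recursive f" "recursive g" "recursive h"
  shows "recursive (\<lambda>e. list_encode (replicate (f e) (g e) @ list_decode (h e)))"
proof -
  have *: "list_encode (replicate n x @ list_decode z) =
      rec_nat z (\<lambda>_ y. Suc (prod_encode (x, y))) n" for n x z
    by (induction n) auto
  have "recursive (\<lambda>e. list_encode (replicate (e 0) (e (Suc 0)) @ list_decode (e (Suc (Suc 0)))))"
    unfolding * by (intro recursive_intros)
  from recursive_subst[OF this, of "case_nat f (case_nat g (\<lambda>_. h))"] show ?thesis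
    using assms by (simp split: nat.split)
qed

lemma decidable_list_all2 [recursive_intros]:
  assumes P: "decidable (\<lambda>e. P (\<lambda>j. e (Suc (Suc j))) (e 0) (e (Suc 0)))"
    and f: "recursive f" and g: "recursive g"
  shows "decidable (\<lambda>e. list_all2 (P e) (list_decode (f e)) (list_decode (g e)))"
proof -
  have "decidable (\<lambda>e. P (\<lambda>j. e (Suc (Suc (Suc j)))) (list_nth (e (Suc 0)) (e 0)) (list_nth (e (Suc (Suc 0))) (e 0)))"
    using decidable_subst[OF P, of "case_nat (\<lambda>e. list_nth (e (Suc 0)) (e 0))
      (case_nat (\<lambda>e. list_nth (e (Suc (Suc 0))) (e 0)) (\<lambda>j e. e (Suc (Suc (Suc j)))))"]
    by (simp add: recursive_var recursive_list_nth split: nat.split)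
  then have "decidable (\<lambda>e. length (list_decode (e 0)) = length (list_decode (e (Suc 0))) \<and>
      (\<forall>i<length (list_decode (e 0)). P (\<lambda>j. e (Suc (Suc j))) (list_nth (e 0) i) (list_nth (e (Suc 0)) i)))"
    by (intro recursive_intros)
  from decidable_subst[OF this, of "case_nat f (case_nat g (\<lambda>j e. e j))"]
  have "decidable (\<lambda>e. length (list_decode (f e)) = length (list_decode (g e)) \<and>
      (\<forall>i<length (list_decode (f e)). P e (list_nth (f e) i) (list_nth (g e) i)))"
    by (simp add: f g recursive_var split: nat.split)
  moreover have "length (list_decode y) = length (list_decode z) \<and>
      (\<forall>i<length (list_decode y). P e (list_nth y i) (list_nth z i)) \<longleftrightarrow>
      list_all2 (P e) (list_decode y) (list_decode z)" for e y z
    by (auto simp: list_all2_conv_all_nth list_nth)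
  ultimately show ?thesis by (simp only:)
qed

lemma decidable_Ball [recursive_intros]:
  assumes P: "decidable (\<lambda>e. P (\<lambda>j. e (Suc j)) (e 0))" and f: "recursive f"
  shows "decidable (\<lambda>e. \<forall>x\<in>set (list_decode (f e)). P e x)"
proof -
  have "decidable (\<lambda>e. P (\<lambda>j. e (Suc (Suc j))) (e 0))"
    using decidable_subst[OF P, of "case_nat (\<lambda>e. e 0) (\<lambda>j e. e (Suc (Suc j)))"]
    by (simp add: recursive_var split: nat.split)
  from decidable_list_all2[of "\<lambda>e x _. P e x", OF this f f] show ?thesis
    by (simp only: list_all2_same)
qed

lemma decidable_Bex [recursive_intros]:
  assumes "decidable (\<lambda>e. P (\<lambda>j. e (Suc j)) (e 0))" and "recursive f"
  shows "decidable (\<lambda>e. \<exists>x\<in>set (list_decode (f e)). P e x)"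
  using decidable_not[OF decidable_Ball[of "\<lambda>e x. \<not> P e x", OF decidable_not[OF assms(1)] assms(2)]]
  by simp

lemma decidable_mem [recursive_intros]:
  assumes "recursive f" "recursive g"
  shows "decidable (\<lambda>e. g e \<in> set (list_decode (f e)))"
proof -
  have "decidable (\<lambda>e. \<exists>x\<in>set (list_decode (e 0)). x = e (Suc 0))"
    by (intro decidable_Bex recursive_intros)
  from decidable_subst[OF this, of "case_nat f (\<lambda>_. g)"] assms show ?thesis
    by (simp split: nat.split)
qed

section \<open>A universal recursively enumerable relation\<close>

fun recf_code :: "recf \<Rightarrow> nat" where
  "recf_code Zero = prod_encode (0, 0)"
| "recf_code Succ = prod_encode (1, 0)"
| "recf_code (Proj i) = prod_encode (2, i)"
| "recf_code (Comp f gs) = prod_encode (3, prod_encode (recf_code f, list_encode (map recf_code gs)))"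
| "recf_code (Prim f g) = prod_encode (4, prod_encode (recf_code f, recf_code g))"
| "recf_code (Mu f) = prod_encode (5, recf_code f)"

abbreviation claim :: "nat \<Rightarrow> nat \<Rightarrow> nat \<Rightarrow> nat" where
  "claim c x y \<equiv> prod_encode (c, prod_encode (x, y))"

text \<open>
  \<open>claim c x y\<close> codes the claim that the function with code \<open>c\<close> has value \<open>y\<close> at the argument
  tuple with code \<open>x\<close>; \<open>inference S c x y\<close> says that it follows from claims in \<open>S\<close> by one of
  the rules of \<open>rec_eval\<close>. A nonzero \<open>x\<close> codes a nonempty tuple with head \<open>pfst (x - 1)\<close> and
  a tail coded by \<open>psnd (x - 1)\<close>.
\<close>

definition inference :: "nat set \<Rightarrow> nat \<Rightarrow> nat \<Rightarrow> nat \<Rightarrow> bool" where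
  "inference S c x y \<longleftrightarrow>
     pfst c = 0 \<and> y = 0 \<or>
     pfst c = 1 \<and> x \<noteq> 0 \<and> y = Suc (pfst (x - 1)) \<or>
     pfst c = 2 \<and> psnd c < length (list_decode x) \<and> y = list_nth x (psnd c) \<or>
     pfst c = 3 \<and> (\<exists>t\<in>S. pfst t = pfst (psnd c) \<and> psnd (psnd t) = y \<and>
        list_all2 (\<lambda>g z. claim g x z \<in> S)
          (list_decode (psnd (psnd c))) (list_decode (pfst (psnd t)))) \<or>
     pfst c = 4 \<and> x \<noteq> 0 \<and> pfst (x - 1) = 0 \<and> claim (pfst (psnd c)) (psnd (x - 1)) y \<in> S \<or>
     pfst c = 4 \<and> x \<noteq> 0 \<and> pfst (x - 1) \<noteq> 0 \<and>
       (\<exists>t\<in>S. pfst t = c \<and>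
          pfst (psnd t) = Suc (prod_encode (pfst (x - 1) - 1, psnd (x - 1))) \<and>
          claim (psnd (psnd c))
            (Suc (prod_encode (pfst (x - 1) - 1, Suc (prod_encode (psnd (psnd t), psnd (x - 1)))))) y \<in> S) \<or>
     pfst c = 5 \<and> claim (psnd c) (Suc (prod_encode (y, x))) 0 \<in> S \<and>
       (\<forall>i<y. \<exists>t\<in>S. pfst t = psnd c \<and> pfst (psnd t) = Suc (prod_encode (i, x)) \<and>
          0 < psnd (psnd t))"

section \<open>Formal derivations\<close>

lemma inference_mono: "inference S c x y \<Longrightarrow> S \<subseteq> T \<Longrightarrow> inference T c x y"
  \<comment> \<open>\<open>S\<close> occurs only positively in each rule.\<close>
  unfolding inference_def
  by (elim disj_forward conj_forward bexE asm_rl)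
     (auto 0 4 elim!: list_all2_mono)

text \<open>A finite certificate for evaluations. Premises stand to the right of their conclusion,
  so a derivation is extended by consing.\<close>

fun derivation :: "nat list \<Rightarrow> bool" where
  "derivation [] \<longleftrightarrow> True"
| "derivation (t # ts) \<longleftrightarrow>
     derivation ts \<and> inference (set ts) (pfst t) (pfst (psnd t)) (psnd (psnd t))"

text \<open>Replaces the recursion over the list by a bounded quantifier over positions, which
  \<open>decidable_all\<close> handles.\<close>

lemma derivation_iff_nth:
  "derivation ts \<longleftrightarrow> (\<forall>i<length ts. inference (set (drop (Suc i) ts))
     (pfst (ts ! i)) (pfst (psnd (ts ! i))) (psnd (psnd (ts ! i))))"
  by (induction ts) (auto simp: All_less_Suc2)

lemma decidable_derivation:
  assumes "recursive f"
  shows "decidable (\<lambda>e. derivation (list_decode (f e)))"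
proof -
  have "decidable (\<lambda>e. inference (set (list_decode (e 0))) (e (Suc 0)) (e (Suc (Suc 0))) (e (Suc (Suc (Suc 0)))))"
    unfolding inference_def by (intro recursive_intros)
  \<comment> \<open>The premises become the part of the list \<open>e (Suc 0)\<close> after position
    \<open>e 0\<close>, the other variables the three components of the claim at that
    position.\<close>
  from decidable_subst[OF this, of "case_nat (\<lambda>e. list_encode (drop (Suc (e 0)) (list_decode (e (Suc 0)))))
    (case_nat (\<lambda>e. pfst (list_nth (e (Suc 0)) (e 0))) (case_nat (\<lambda>e. pfst (psnd (list_nth (e (Suc 0)) (e 0))))
      (\<lambda>_ e. psnd (psnd (list_nth (e (Suc 0)) (e 0))))))"]
  have "decidable (\<lambda>e. inference (set (drop (Suc (e 0)) (list_decode (e (Suc 0)))))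
     (pfst (list_nth (e (Suc 0)) (e 0))) (pfst (psnd (list_nth (e (Suc 0)) (e 0))))
     (psnd (psnd (list_nth (e (Suc 0)) (e 0)))))"
    by (simp add: recursive_intros split: nat.split)
  then have "decidable (\<lambda>e. \<forall>i<length (list_decode (e 0)). inference (set (drop (Suc i) (list_decode (e 0))))
     (pfst (list_nth (e 0) i)) (pfst (psnd (list_nth (e 0) i))) (psnd (psnd (list_nth (e 0) i))))"
    by (intro decidable_all recursive_intros)
  then have "decidable (\<lambda>e. derivation (list_decode (e 0)))"
    by (simp add: derivation_iff_nth list_nth cong: conj_cong imp_cong)
  from decidable_subst[OF this, of "\<lambda>_. f"] assms show ?thesis by simp
qed

lemma derivation_append: "derivation ts \<Longrightarrow> derivation us \<Longrightarrow> derivation (ts @ us)"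
  by (induction ts) (auto elim: inference_mono)

definition derivable :: "nat \<Rightarrow> bool" where
  "derivable t \<longleftrightarrow> (\<exists>ts. derivation ts \<and> t \<in> set ts)"

text \<open>Derivations of the finitely many premises are concatenated, and the conclusion is put in
  front.\<close>

lemma derivable_inference:
  assumes "inference S c x y" "finite S" "\<And>t. t \<in> S \<Longrightarrow> derivable t"
  shows "derivable (claim c x y)"
proof -
  have "\<exists>ts. derivation ts \<and> S \<subseteq> set ts"
    using assms(2,3)
  proof (induction S)
    case empty
    show ?case by (rule exI[of _ "[]"]) simp
  next
    case (insert t S)
    then obtain ts us where "derivation ts" "S \<subseteq> set ts" "derivation us" "t \<in> set us"
      unfolding derivable_def by blast
    then show ?case by (intro exI[of _ "us @ ts"]) (auto intro: derivation_append)
  qed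
  then obtain ts where "derivation ts" "S \<subseteq> set ts" by blast
  then have "derivation (claim c x y # ts)"
    using inference_mono[OF assms(1)] by simp
  then show ?thesis unfolding derivable_def by (intro exI[of _ "claim c x y # ts"]) simp
qed

section \<open>Completeness and soundness of derivations\<close>

lemma derivable_complete:
  "rec_eval c xs y \<Longrightarrow> derivable (claim (recf_code c) (list_encode xs) y)"
proof (induction rule: rec_eval.induct)
  case (1 xs)
  show ?case by (rule derivable_inference[of "{}"]) (auto simp: inference_def)
next
  case (2 x xs)
  show ?case by (rule derivable_inference[of "{}"]) (auto simp: inference_def)
next
  case (3 i xs)
  then show ?case by (intro derivable_inference[of "{}"]) (auto simp: inference_def list_nth)
next
  case (4 xs gs ys f z)
  \<comment> \<open>The premises of a composition: one claim for each inner function in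
    \<open>?T\<close>, and the claim \<open>?t\<close> for the outer function at their
    values.\<close>
  let ?T = "(\<lambda>(g, y). claim (recf_code g) (list_encode xs) y) ` set (zip gs ys)"
  let ?t = "claim (recf_code f) (list_encode ys) z"
  have "list_all2 (\<lambda>g z. claim g (list_encode xs) z \<in> insert ?t ?T) (map recf_code gs) ys"
    using "4.IH"(1)
    by (auto simp: list_all2_conv_all_nth set_zip image_iff intro!: disjI2)
  then have "inference (insert ?t ?T) (recf_code (Comp f gs)) (list_encode xs) z"
    unfolding inference_def by simp
  moreover have "derivable t" if "t \<in> insert ?t ?T" for t
    using that "4.IH" by (auto simp: list_all2_iff)
  ultimately show ?case by (intro derivable_inference[of "insert ?t ?T"]) auto
next
  case (5 f xs y g)
  then show ?case
    by (intro derivable_inference[of "{claim (recf_code f) (list_encode xs) y}"])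
       (auto simp: inference_def)
next
  case (6 f g n xs y z)
  then show ?case
    by (intro derivable_inference[of "{claim (recf_code (Prim f g)) (list_encode (n # xs)) y,
          claim (recf_code g) (list_encode (n # y # xs)) z}"])
       (auto simp: inference_def)
next
  case (7 n f xs)
  \<comment> \<open>The nonzero values below the minimum are only known to exist; fixing them by
    \<open>v\<close> gives a finite set of premises.\<close>
  from "7.IH"(1) obtain v where
    v: "\<And>i. i < n \<Longrightarrow> derivable (claim (recf_code f) (list_encode (i # xs)) (Suc (v i)))"
    by metis
  let ?T = "insert (claim (recf_code f) (list_encode (n # xs)) 0)
    ((\<lambda>i. claim (recf_code f) (list_encode (i # xs)) (Suc (v i))) ` {..<n})"
  have "inference ?T (recf_code (Mu f)) (list_encode xs) n"
    unfolding inference_def by (intro disjI2) auto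
  then show ?case
    using v "7.IH"(2) by (intro derivable_inference[of ?T]) auto
qed

text \<open>The head constructor of \<open>c\<close> fixes the tag and thereby the possible rules;
  the remaining components are codes of its subprograms, to which \<open>S\<close> applies.
  \<open>S\<close> asserts nothing about claims whose first component codes no program.\<close>

lemma inference_sound:
  assumes "inference S (recf_code c) x y"
    and S: "\<And>c t. t \<in> S \<Longrightarrow> recf_code c = pfst t \<Longrightarrow> rec_eval c (list_decode (pfst (psnd t))) (psnd (psnd t))"
  shows "rec_eval c (list_decode x) y"
proof -
  have S': "rec_eval c (list_decode x) y" if "claim (recf_code c) x y \<in> S" for c x y
    using S[OF that] by simp
  have x: "list_decode x = pfst (x - Suc 0) # list_decode (psnd (x - Suc 0))" if "x \<noteq> 0"
    using that by (cases x) (auto split: prod.split)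
  show ?thesis
  proof (cases c)
    case Zero
    then show ?thesis using assms(1) by (auto simp: inference_def intro: rec_eval.intros)
  next
    case Succ
    then show ?thesis using assms(1) x by (auto simp: inference_def intro: rec_eval.intros)
  next
    case (Proj i)
    then show ?thesis
      using assms(1) by (auto simp: inference_def list_nth intro: rec_eval.intros)
  next
    case (Comp f gs)
    then obtain t where t: "t \<in> S" "pfst t = recf_code f" "psnd (psnd t) = y"
      "list_all2 (\<lambda>g z. claim g x z \<in> S) (map recf_code gs) (list_decode (pfst (psnd t)))"
      using assms(1) by (auto simp: inference_def)
    have "list_all2 (\<lambda>g z. rec_eval g (list_decode x) z) gs (list_decode (pfst (psnd t)))"
      using t(4) S' by (auto simp: list_all2_conv_all_nth)
    then show ?thesis unfolding Comp using S[OF t(1), of f] t(2,3) by (auto intro: rec_eval.intros(4))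
  next
    case (Prim f g)
    define n where "n = pfst (x - Suc 0)"
    define z where "z = psnd (x - Suc 0)"
    have xne: "x \<noteq> 0" using assms(1) Prim by (auto simp: inference_def)
    note x = x[OF xne, folded n_def z_def]
    show ?thesis
    proof (cases n)
      case 0
      then have "claim (recf_code f) z y \<in> S"
        using assms(1) Prim by (auto simp: inference_def n_def z_def)
      from S'[OF this] show ?thesis unfolding x Prim 0 by (rule rec_eval.intros(5))
    next
      case (Suc m)
      then obtain t where t: "t \<in> S" "pfst t = recf_code (Prim f g)" "pfst (psnd t) = Suc (prod_encode (m, z))"
         "claim (recf_code g) (Suc (prod_encode (m, Suc (prod_encode (psnd (psnd t), z))))) y \<in> S"
        using assms(1) Prim by (auto simp: inference_def n_def[symmetric] z_def[symmetric])
      have "rec_eval (Prim f g) (m # list_decode z) (psnd (psnd t))"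
        using S[OF t(1) t(2)[symmetric]] t(3) by simp
      moreover have "rec_eval g (m # psnd (psnd t) # list_decode z) y"
        using S'[OF t(4)] by simp
      ultimately show ?thesis unfolding x Prim Suc by (rule rec_eval.intros(6))
    qed
  next
    case (Mu f)
    then have T: "claim (recf_code f) (Suc (prod_encode (y, x))) 0 \<in> S"
        "\<And>i. i < y \<Longrightarrow> \<exists>t\<in>S. pfst t = recf_code f \<and> pfst (psnd t) = Suc (prod_encode (i, x)) \<and> 0 < psnd (psnd t)"
      using assms(1) by (auto simp: inference_def)
    show ?thesis unfolding Mu
    proof (intro rec_eval.intros(7) allI impI)
      show "rec_eval f (y # list_decode x) 0" using S'[OF T(1)] by simp
      show "\<exists>z. rec_eval f (i # list_decode x) (Suc z)" if i: "i < y" for i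
      proof -
        obtain t where t: "t \<in> S" "pfst t = recf_code f"
          "pfst (psnd t) = Suc (prod_encode (i, x))" "0 < psnd (psnd t)"
          using T(2)[OF i] by blast
        then show ?thesis using S[OF t(1) t(2)[symmetric]] by (cases "psnd (psnd t)") auto
      qed
    qed
  qed
qed

lemma derivation_sound:
  "derivation ts \<Longrightarrow> t \<in> set ts \<Longrightarrow> recf_code c = pfst t \<Longrightarrow>
     rec_eval c (list_decode (pfst (psnd t))) (psnd (psnd t))"
proof (induction ts arbitrary: t c)
  case (Cons u us)
  show ?case
  proof (cases "t \<in> set us")
    case True
    then show ?thesis using Cons by simp
  next
    case False
    then have "inference (set us) (recf_code c) (pfst (psnd t)) (psnd (psnd t))"
      using Cons.prems by simp
    then show ?thesis by (rule inference_sound) (use Cons.IH Cons.prems(1) in auto)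
  qed
qed simp

lemma derivable_iff_rec_eval:
  "derivable (claim (recf_code c) (list_encode xs) y) \<longleftrightarrow> rec_eval c xs y"
proof
  assume "derivable (claim (recf_code c) (list_encode xs) y)"
  then obtain ts where "derivation ts" "claim (recf_code c) (list_encode xs) y \<in> set ts"
    unfolding derivable_def by blast
  from derivation_sound[OF this, of c] show "rec_eval c xs y" by simp
qed (rule derivable_complete)

text \<open>In the manner of Kleene's normal form: \<open>m\<close> is the code of a program
  deciding \<open>R\<close>, and \<open>k\<close> certifies a run of it with the answer 1.\<close>

theorem universal_decidable:
  "\<exists>W. decidable (\<lambda>e. W (e 0) (e (Suc 0)) (e (Suc (Suc 0)))) \<and>
     (\<forall>R. decidable3 R \<longrightarrow>
        (\<exists>m. \<forall>n x. (\<exists>y. R n x y) \<longleftrightarrow> (\<exists>k. W (prod_encode (m, n)) x k)))"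
proof -
  \<comment> \<open>\<open>z\<close> pairs the program code with \<open>n\<close>, and
    \<open>k\<close> pairs the witness \<open>y\<close> with a coded derivation.\<close>
  define W where "W z x k \<longleftrightarrow> derivation (list_decode (psnd k)) \<and>
    claim (pfst z) (list_encode [psnd z, x, pfst k]) 1 \<in> set (list_decode (psnd k))" for z x k
  have "decidable (\<lambda>e. W (e 0) (e (Suc 0)) (e (Suc (Suc 0))))"
    unfolding W_def list_encode.simps
    by (intro decidable_derivation recursive_intros)
  moreover have "\<exists>m. \<forall>n x. (\<exists>y. R n x y) \<longleftrightarrow> (\<exists>k. W (prod_encode (m, n)) x k)"
    if "decidable3 R" for R
  proof -
    from that obtain c where c: "\<And>n x y. rec_eval c [n, x, y] (of_bool (R n x y))"
      unfolding decidable3_def by blast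
    \<comment> \<open>Where \<open>R\<close> fails the program has the value \<open>0\<close>, hence
      by determinism not \<open>1\<close>.\<close>
    have "rec_eval c [n, x, y] 1 \<longleftrightarrow> R n x y" for n x y
      using c[of n x y] rec_eval_deterministic[OF c[of n x y], of 1] by (cases "R n x y") auto
    then have R: "R n x y \<longleftrightarrow> derivable (claim (recf_code c) (list_encode [n, x, y]) 1)" for n x y
      by (simp only: derivable_iff_rec_eval)
    have "(\<exists>y. R n x y) \<longleftrightarrow> (\<exists>k. W (prod_encode (recf_code c, n)) x k)" for n x
    proof
      assume "\<exists>y. R n x y"
      then obtain y ts where "derivation ts" "claim (recf_code c) (list_encode [n, x, y]) 1 \<in> set ts"
        unfolding R derivable_def by blast
      then have "W (prod_encode (recf_code c, n)) x (prod_encode (y, list_encode ts))"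
        by (simp add: W_def)
      then show "\<exists>k. W (prod_encode (recf_code c, n)) x k" ..
    next
      assume "\<exists>k. W (prod_encode (recf_code c, n)) x k"
      then show "\<exists>y. R n x y" unfolding R derivable_def by (auto simp: W_def)
    qed
    then show ?thesis by blast
  qed
  ultimately show ?thesis by blast
qed

section \<open>The environment\<close>

text \<open>Shifting \<open>p\<close> at each leading \<alpha> counts these: after \<open>n\<close>
  of them \<open>p 0\<close> stands for the original \<open>p n\<close>.\<close>

fun mass :: "(nat \<Rightarrow> real) \<Rightarrow> action list \<Rightarrow> real" where
  "mass p [] = 1"
| "mass p (Alpha # as) = mass (\<lambda>n. p (Suc n)) as"
| "mass p [Beta] = 1"
| "mass p (Beta # Alpha # as) = p 0"
| "mass p (Beta # Beta # as) = 1"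

definition switching_env :: "(nat \<Rightarrow> real) \<Rightarrow> environment" where
  "switching_env p es as = (if set es \<subseteq> {(False, True)} then mass p as else 0)"

lemma mass_replicate: "mass p (replicate n Alpha @ as) = mass (\<lambda>j. p (n + j)) as"
  by (induction n arbitrary: p) simp_all

lemma mass_bounds: "(\<And>n. 0 \<le> p n \<and> p n \<le> 1) \<Longrightarrow> 0 \<le> mass p as \<and> mass p as \<le> 1"
  by (induction p as rule: mass.induct) auto

text \<open>Mass can be lost only at the action right after the first \<beta>; all other actions
  preserve it.\<close>

lemma mass_append_le: "(\<And>n. 0 \<le> p n \<and> p n \<le> 1) \<Longrightarrow> mass p (as @ [a]) \<le> mass p as"
proof (induction p as rule: mass.induct)
  case (1 p)
  then show ?case using mass_bounds[of p "[a]"] by simp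
next
  case (3 p)
  then show ?case by (cases a) auto
qed auto

lemma mass_cases:
  obtains n r where "as = replicate n Alpha @ Beta # Alpha # r" "mass p as = p n"
  | "\<nexists>n r. as = replicate n Alpha @ Beta # Alpha # r" "mass p as = 1"
proof -
  have "(\<exists>n r. as = replicate n Alpha @ Beta # Alpha # r \<and> mass p as = p n) \<or>
    (\<nexists>n r. as = replicate n Alpha @ Beta # Alpha # r) \<and> mass p as = 1"
  proof (cases "\<exists>n r. as = replicate n Alpha @ Beta # Alpha # r")
    case True
    then show ?thesis by (auto simp: mass_replicate)
  next
    case False
    then have "mass p as = 1"
    proof (induction p as rule: mass.induct)
      case (2 p as)
      have "\<nexists>n r. as = replicate n Alpha @ Beta # Alpha # r"
      proof
        assume "\<exists>n r. as = replicate n Alpha @ Beta # Alpha # r"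
        then obtain n r where "as = replicate n Alpha @ Beta # Alpha # r" by blast
        then have "Alpha # as = replicate (Suc n) Alpha @ Beta # Alpha # r" by simp
        then show False using "2.prems" by blast
      qed
      then show ?case using "2.IH" by simp
    next
      case (4 p as)
      have "Beta # Alpha # as = replicate 0 Alpha @ Beta # Alpha # as" by simp
      then show ?case using "4.prems" by blast
    qed auto
    then show ?thesis using False by blast
  qed
  then show ?thesis using that by blast
qed

text \<open>Only one percept carries mass, so the sum over percepts collapses and the inequality
  reduces to \<open>mass_append_le\<close>.\<close>

lemma switching_env_semimeasure:
  assumes p: "\<And>n. 0 \<le> p n \<and> p n \<le> 1"
  shows "chronological_contextual_semimeasure (switching_env p)"
proof -
  have "(\<Sum>e\<in>UNIV. switching_env p (es @ [e]) (as @ [a])) \<le> switching_env p es as" for es as a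
  proof -
    have "(\<Sum>e\<in>UNIV. switching_env p (es @ [e]) (as @ [a])) =
        (\<Sum>e\<in>UNIV. if e = (False, True) then switching_env p es (as @ [a]) else 0)"
      by (intro sum.cong) (auto simp: switching_env_def)
    also have "\<dots> = switching_env p es (as @ [a])" by simp
    also have "\<dots> \<le> switching_env p es as"
      using mass_append_le[OF p] by (simp add: switching_env_def)
    finally show ?thesis .
  qed
  then show ?thesis
    using mass_bounds[OF p] by (auto simp: chronological_contextual_semimeasure_def switching_env_def)
qed

section \<open>Values at the decision points\<close>

lemma extend_eq: "\<exists>as. length as = length es \<and> extend \<pi> h es = h @ zip as es"
proof (induction es arbitrary: h)
  case (Cons e es)
  obtain as where "length as = length es" "extend \<pi> (h @ [(\<pi> h, e)]) es = (h @ [(\<pi> h, e)]) @ zip as es"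
    using Cons by blast
  then show ?case by (intro exI[of _ "\<pi> h # as"]) simp
qed simp

definition decision_point :: "nat \<Rightarrow> history" where
  "decision_point n = replicate n (Alpha, (False, True)) @ [(Beta, (False, True))]"

lemma env_hist_decision_point: "env_hist (switching_env p) (decision_point n) = 1"
  by (simp add: env_hist_def decision_point_def switching_env_def mass_replicate set_replicate_conv_if)

text \<open>Along the only possible percept sequence all rewards are 1, and the mass stays at
  \<open>?q\<close> from the first step on. Every time step thus contributes \<open>?q\<close>, and
  the discounts cancel against the normalisation.\<close>

lemma val_decision_point:
  assumes \<gamma>: "summable \<gamma>" "\<And>t. discount_tail \<gamma> t > 0"
  shows "val \<gamma> (switching_env p) \<pi> (decision_point n) =
    (if \<pi> (decision_point n) = Alpha then p n else 1)" (is "_ = ?q")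
proof -
  let ?h = "decision_point n"
  let ?t = "length ?h + 1"
  have ext: "env_hist (switching_env p) (extend \<pi> ?h (e # es)) =
      (if set (e # es) \<subseteq> {(False, True)} then ?q else 0)" for e es
  proof -
    \<comment> \<open>The actions after the first one stay unspecified, since they no longer affect
      the mass.\<close>
    obtain as where "length as = length es"
      "extend \<pi> (?h @ [(\<pi> ?h, e)]) es = (?h @ [(\<pi> ?h, e)]) @ zip as es"
      using extend_eq by blast
    then show ?thesis
      by (cases "\<pi> ?h") (auto simp: env_hist_def decision_point_def switching_env_def mass_replicate)
  qed
  have "(\<Sum>es | length es = Suc j. reward (last es) *
      (env_hist (switching_env p) (extend \<pi> ?h es) / env_hist (switching_env p) ?h)) = ?q" for j
  proof -
    \<comment> \<open>The summand is a delta at the constant percept list, the form that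
      \<open>sum.delta\<close> evaluates.\<close>
    have "reward (last es) * (env_hist (switching_env p) (extend \<pi> ?h es) / env_hist (switching_env p) ?h) =
        (if es = replicate (Suc j) (False, True) then ?q else 0)" if "length es = Suc j" for es
    proof -
      obtain e es' where es: "es = e # es'" using \<open>length es = Suc j\<close> by (cases es) auto
      have *: "es = replicate (Suc j) (False, True) \<longleftrightarrow> set es \<subseteq> {(False, True)}"
        using that replicate_eqI[of es "Suc j" "(False, True)"] by (auto simp del: replicate_Suc)
      have r: "reward (last es) = 1" if "set es \<subseteq> {(False, True)}"
        using that last_in_set[of es] es by (auto simp: reward_def)
      then show ?thesis
        unfolding * env_hist_decision_point ext[of e es', folded es] using r by auto
    qed
    then have "(\<Sum>es | length es = Suc j. reward (last es) *
      (env_hist (switching_env p) (extend \<pi> ?h es) / env_hist (switching_env p) ?h)) =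
      (\<Sum>es | length es = Suc j. if es = replicate (Suc j) (False, True) then ?q else 0)"
      by (intro sum.cong) auto
    also have "\<dots> = ?q"
      using finite_lists_length_eq[of "UNIV :: percept set" "Suc j"]
      by (subst sum.delta) (auto simp del: replicate_Suc)
    finally show ?thesis .
  qed
  moreover have "summable (\<lambda>j. \<gamma> (?t + j))"
    using \<gamma>(1) by (subst add.commute) (rule summable_ignore_initial_segment)
  ultimately have "val \<gamma> (switching_env p) \<pi> ?h = 1 / discount_tail \<gamma> ?t * (discount_tail \<gamma> ?t * ?q)"
    unfolding val_def Let_def discount_tail_def by (simp only: suminf_mult2)
  then show ?thesis using \<gamma>(2)[of ?t] by simp
qed

text \<open>The history has probability 1, so the tie-breaking rule binds every policy as in
  \<open>ainu\<close>. With the action fixed the value is the same for all policies, and each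
  supremum is over a constant.\<close>

lemma ainu_decision_point:
  assumes "summable \<gamma>" "\<And>t. discount_tail \<gamma> t > 0" and "ainu \<gamma> (switching_env p) \<pi>"
  shows "\<pi> (decision_point n) = Alpha \<longleftrightarrow> 1 \<le> p n"
proof -
  have "opt_act_val \<gamma> (switching_env p) (decision_point n) a = (if a = Alpha then p n else 1)" for a
    unfolding opt_act_val_def act_val_def val_decision_point[OF assms(1,2)] by simp
  then show ?thesis
    using assms(3) by (simp add: ainu_def env_hist_decision_point)
qed

section \<open>A \<open>\<Pi>\<^sup>0\<^sub>2\<close> condition encoded in a supremum\<close>

definition stage_value :: "(nat \<Rightarrow> nat \<Rightarrow> bool) \<Rightarrow> real" where
  "stage_value Q = (SUP m\<in>{m. \<forall>i<m. \<exists>k. Q i k}. real m / real (Suc m))"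

text \<open>A strict lower bound is witnessed by a single finite stage; this existential form is the
  source of lower semicomputability.\<close>

lemma stage_value_less_iff:
  "x < stage_value Q \<longleftrightarrow> (\<exists>m. (\<forall>i<m. \<exists>k. Q i k) \<and> x < real m / real (Suc m))"
proof -
  have "bdd_above ((\<lambda>m. real m / real (Suc m)) ` {m. \<forall>i<m. \<exists>k. Q i k})"
    by (intro bdd_aboveI2[where M = 1]) simp
  moreover have "0 \<in> {m. \<forall>i<m. \<exists>k. Q i k}" by simp
  ultimately show ?thesis
    unfolding stage_value_def by (subst less_cSUP_iff) auto
qed

lemma stage_value_bounds: "0 \<le> stage_value Q \<and> stage_value Q \<le> 1"
proof
  show "0 \<le> stage_value Q"
  proof (rule ccontr)
    assume "\<not> 0 \<le> stage_value Q"
    \<comment> \<open>Stage \<open>0\<close> always qualifies, so a negative supremum would be less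
      than itself.\<close>
    moreover have "stage_value Q < 0 / real (Suc 0) \<longrightarrow> stage_value Q < stage_value Q"
      unfolding stage_value_less_iff[of "stage_value Q"] by (intro impI exI[of _ 0]) simp
    ultimately show False by simp
  qed
  show "stage_value Q \<le> 1"
    unfolding not_less[symmetric] stage_value_less_iff by (auto simp: not_less)
qed

text \<open>The bounds \<open>m / (m + 1)\<close> increase to 1 without reaching it, so the value 1
  requires arbitrarily large stages.\<close>

lemma stage_value_ge_1_iff: "1 \<le> stage_value Q \<longleftrightarrow> (\<forall>i. \<exists>k. Q i k)"
proof
  assume 1: "1 \<le> stage_value Q"
  show "\<forall>i. \<exists>k. Q i k"
  proof
    fix i
    have "real i / real (Suc i) < stage_value Q"
      by (rule less_le_trans[OF _ 1]) simp
    then obtain m where m: "\<forall>i<m. \<exists>k. Q i k" "real i / real (Suc i) < real m / real (Suc m)"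
      unfolding stage_value_less_iff by blast
    then have "i < m" by (simp add: field_simps)
    then show "\<exists>k. Q i k" using m(1) by blast
  qed
next
  assume Q: "\<forall>i. \<exists>k. Q i k"
  have "x < stage_value Q" if x: "x < 1" for x
  proof -
    obtain m :: nat where "inverse (real (Suc m)) < 1 - x"
      using reals_Archimedean[of "1 - x"] x by (auto simp del: of_nat_Suc)
    moreover have "real m / real (Suc m) = 1 - inverse (real (Suc m))"
      by (simp add: field_simps)
    ultimately have "x < real m / real (Suc m)" by linarith
    then show ?thesis unfolding stage_value_less_iff using Q by blast
  qed
  then show "1 \<le> stage_value Q" by (meson less_irrefl not_less)
qed

lemma less_list_encode_replicate_append:
  "n < list_encode (replicate n x @ y # z # list_decode r) \<and>
   r < list_encode (replicate n x @ y # z # list_decode r)"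
proof (induction n)
  case 0
  show ?case
    using le_prod_encode_2[of r z] le_prod_encode_2[of "Suc (prod_encode (z, r))" y] by simp
next
  case (Suc n)
  then show ?case
    using le_prod_encode_2[of "list_encode (replicate n x @ y # z # list_decode r)" x] by simp
qed

text \<open>The code of \<open>n\<close> times \<alpha>, then \<beta>, \<alpha> and the list coded
  by \<open>r\<close>: the action lists on which \<open>mass\<close> takes the value
  \<open>p n\<close>. The form is the one that \<open>recursive_replicate_append\<close>
  accepts.\<close>

definition switch_code :: "nat \<Rightarrow> nat \<Rightarrow> nat" where
  "switch_code n r = list_encode (replicate n 0 @ list_decode (Suc (prod_encode (1, Suc (prod_encode (0, r))))))"

text \<open>Each cons strictly increases a list code. These bounds justify the bounded quantifiers
  over \<open>n\<close> and \<open>r\<close> in \<open>below\<close>.\<close>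

lemma switch_code_bounds: "n < switch_code n r" "r < switch_code n r"
  using less_list_encode_replicate_append[of n 0 1 0 r] by (auto simp: switch_code_def)

lemma map_action_code_eq_switch:
  "map action_code as = replicate n 0 @ 1 # 0 # rs \<longleftrightarrow>
   (\<exists>as'. as = replicate n Alpha @ Beta # Alpha # as' \<and> map action_code as' = rs)"
proof -
  have a: "action_code a = 0 \<longleftrightarrow> a = Alpha" "action_code a = 1 \<longleftrightarrow> a = Beta" for a
    by (cases a; simp)+
  show ?thesis
  proof (induction n arbitrary: as)
    case 0
    show ?case by (auto simp: map_eq_Cons_conv a simp del: One_nat_def)
  next
    case (Suc n)
    show ?case using Suc by (cases as) (auto simp: a)
  qed
qed

text \<open>\<open>r\<close> ranges over all numbers, but equality with the code of an action list
  forces it to code one too.\<close>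

lemma switch_code_iff:
  "(\<exists>r. list_encode (map action_code as) = switch_code n r) \<longleftrightarrow>
   (\<exists>as'. as = replicate n Alpha @ Beta # Alpha # as')"
proof -
  have "list_encode (map action_code as) = switch_code n r \<longleftrightarrow>
      map action_code as = replicate n 0 @ 1 # 0 # list_decode r" for r
    unfolding switch_code_def list_encode_eq by simp
  then show ?thesis
    unfolding map_action_code_eq_switch by (metis list_encode_inverse)
qed


section \<open>Recognising percept and action codes\<close>

lemma percept_code_simps [simp]:
  "percept_code (False, False) = 0" "percept_code (False, True) = 1"
  "percept_code (True, False) = 2" "percept_code (True, True) = 4"
  by (simp_all add: percept_code_def prod_encode_def triangle_def)

lemma inj_percept_code: "inj percept_code"
proof
  fix e e' assume "percept_code e = percept_code e'"
  then show "e = e'"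
    by (cases e; cases e') (auto simp: percept_code_def of_bool_eq_iff)
qed

lemma range_percept_code: "range percept_code = {0, 1, 2, 4}"
  unfolding UNIV_Times_UNIV[symmetric] UNIV_bool by (auto simp: image_iff)

lemma inj_action_code: "inj action_code"
proof
  fix a b assume "action_code a = action_code b"
  then show "a = b" by (cases a; cases b) auto
qed

lemma range_action_code: "range action_code = {0, 1}"
proof -
  have "UNIV = {Alpha, Beta}" using action.exhaust by auto
  then have "range action_code = action_code ` {Alpha, Beta}" by (rule arg_cong)
  then show ?thesis by simp
qed

lemma mem_range_map: "(\<exists>xs. ys = map f xs) \<longleftrightarrow> set ys \<subseteq> range f"
  by (auto simp: ex_map_conv)

text \<open>
  Stage \<open>s\<close> of the enumeration of the fractions below the environment, for the percepts coded by
  \<open>E\<close> and the actions coded by \<open>A\<close>. The fraction has denominator \<open>d + 1\<close> and numerator \<open>i\<close> with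
  \<open>int_encode i = q\<close>; thus \<open>i\<close> is negative if \<open>q\<close> is odd, and \<open>i = q / 2\<close> otherwise.
\<close>

definition below :: "(nat \<Rightarrow> nat \<Rightarrow> nat \<Rightarrow> bool) \<Rightarrow> nat \<Rightarrow> nat \<Rightarrow> nat \<Rightarrow> nat \<Rightarrow> nat \<Rightarrow> bool" where
  "below W E A q d s \<longleftrightarrow>
     (\<exists>j<q. q = Suc (2 * j)) \<or>
     (\<forall>x\<in>set (list_decode E). x = 1) \<and>
     (\<exists>j<Suc q. q = 2 * j \<and>
       (\<not> (\<exists>n<A. \<exists>r<A. A = switch_code n r) \<and> j < Suc d \<or>
        (\<exists>n<A. \<exists>r<A. A = switch_code n r \<and>
          (\<exists>m<s. (\<forall>i<m. \<exists>k<s. W n i k) \<and> j * Suc m < m * Suc d))))"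

section \<open>Correctness and decidability of the enumeration\<close>

lemma of_rat_fraction: "of_rat (fraction i d) = of_int i / real (Suc d)"
  by (simp add: fraction_def of_rat_divide of_rat_add)

text \<open>Cross multiplication leaves a comparison of natural numbers, as tested in
  \<open>below\<close>.\<close>

lemma fraction_less_iff:
  "of_rat (fraction (int j) d) < real m / real (Suc m) \<longleftrightarrow> j * Suc m < m * Suc d"
proof -
  have "real j / real (Suc d) < real m / real (Suc m) \<longleftrightarrow> real (j * Suc m) < real (m * Suc d)"
    by (simp add: field_simps)
  then show ?thesis by (simp only: of_rat_fraction of_int_of_nat_eq of_nat_less_iff)
qed

text \<open>One number \<open>s\<close> can bound \<open>m\<close> and its finitely many witnesses
  together, so a single unbounded search suffices.\<close>

lemma ex_bounded_witness:
  "(\<exists>s. \<exists>m<s. (\<forall>i<m. \<exists>k<s. Q i k) \<and> R m) \<longleftrightarrow> (\<exists>m. (\<forall>i<m. \<exists>k. Q i k) \<and> R m)"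
  for Q :: "nat \<Rightarrow> nat \<Rightarrow> bool"
proof
  assume "\<exists>m. (\<forall>i<m. \<exists>k. Q i k) \<and> R m"
  then obtain m where m: "\<forall>i<m. \<exists>k. Q i k" "R m" by blast
  then obtain k where k: "\<And>i. i < m \<Longrightarrow> Q i (k i)" by metis
  \<comment> \<open>The sum is a convenient upper bound for all chosen witnesses.\<close>
  let ?s = "Suc (m + (\<Sum>i<m. k i))"
  have "k i < ?s" if "i < m" for i
    using member_le_sum[of i "{..<m}" k] that by simp
  then show "\<exists>s. \<exists>m<s. (\<forall>i<m. \<exists>k<s. Q i k) \<and> R m"
    using m(2) k by (intro exI[of _ ?s] exI[of _ m]) auto
qed blast

text \<open>A negative fraction lies below every value. A nonnegative one is not below the value 0
  of percept lists other than the constant one; for that list the two alternatives of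
  \<open>mass_cases\<close> match those in \<open>below\<close>.\<close>

lemma below_iff:
  "(\<exists>s. below W (list_encode (map percept_code es)) (list_encode (map action_code as)) (int_encode i) d s) \<longleftrightarrow>
   of_rat (fraction i d) < switching_env (\<lambda>n. stage_value (W n)) es as"
proof (cases "i < 0")
  case True
  then obtain j where j: "int_encode i = Suc (2 * j)"
    by (auto simp: int_encode_def sum_encode_def)
  have "of_rat (fraction i d) < (0 :: real)"
    using True by (simp add: of_rat_fraction divide_neg_pos)
  also have "0 \<le> switching_env (\<lambda>n. stage_value (W n)) es as"
    using mass_bounds[OF stage_value_bounds] by (simp add: switching_env_def)
  finally show ?thesis
    unfolding below_def j by auto
next
  case False
  then obtain j where j: "i = int j" by (metis nonneg_int_cases not_less)
  then have ij: "int_encode i = 2 * j" by (simp add: int_encode_def sum_encode_def)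
  let ?A = "list_encode (map action_code as)"
  let ?f = "of_rat (fraction i d) :: real"
  have f: "?f = real j / real (Suc d)"
    by (simp add: of_rat_fraction j)
  have f_less_1: "?f < 1 \<longleftrightarrow> j < Suc d"
    by (simp add: f divide_less_eq_1 del: of_nat_Suc)
  have "percept_code e = 1 \<longleftrightarrow> e = (False, True)" for e
    using inj_percept_code[THEN inj_eq, of e "(False, True)"] by simp
  then have es: "(\<forall>x\<in>set (map percept_code es). x = 1) \<longleftrightarrow> set es \<subseteq> {(False, True)}"
    by auto
  have switch: "(\<exists>n<?A. \<exists>r<?A. ?A = switch_code n r \<and> P n) \<longleftrightarrow>
      (\<exists>n. (\<exists>as'. as = replicate n Alpha @ Beta # Alpha # as') \<and> P n)" for P
    unfolding switch_code_iff[symmetric] by (metis switch_code_bounds)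
  \<comment> \<open>Only the last alternative depends on \<open>s\<close>, so the quantifier over
    \<open>s\<close> can be moved inwards to it.\<close>
  have "(\<exists>s. below W (list_encode (map percept_code es)) ?A (int_encode i) d s) \<longleftrightarrow>
      set es \<subseteq> {(False, True)} \<and>
      ((\<nexists>n as'. as = replicate n Alpha @ Beta # Alpha # as') \<and> j < Suc d \<or>
       (\<exists>n. (\<exists>as'. as = replicate n Alpha @ Beta # Alpha # as') \<and>
          (\<exists>s. \<exists>m<s. (\<forall>i<m. \<exists>k<s. W n i k) \<and> j * Suc m < m * Suc d)))"
  proof -
    have "below W (list_encode (map percept_code es)) ?A (int_encode i) d s \<longleftrightarrow>
      set es \<subseteq> {(False, True)} \<and>
      ((\<nexists>n as'. as = replicate n Alpha @ Beta # Alpha # as') \<and> j < Suc d \<or>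
       (\<exists>n. (\<exists>as'. as = replicate n Alpha @ Beta # Alpha # as') \<and>
          (\<exists>m<s. (\<forall>i<m. \<exists>k<s. W n i k) \<and> j * Suc m < m * Suc d)))" for s
    proof -
      have 1: "(\<exists>j'<2 * j. 2 * j = Suc (2 * j')) \<longleftrightarrow> False" by presburger
      have 2: "(\<exists>j'<Suc (2 * j). 2 * j = 2 * j' \<and> P j') \<longleftrightarrow> P j" for P by auto
      show ?thesis
        unfolding below_def ij list_encode_inverse es 1 2 switch[of "\<lambda>_. True", simplified] switch
        by simp
    qed
    then show ?thesis by (simp only:) blast
  qed
  also have "\<dots> \<longleftrightarrow> set es \<subseteq> {(False, True)} \<and>
      ((\<nexists>n as'. as = replicate n Alpha @ Beta # Alpha # as') \<and> ?f < 1 \<or>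
       (\<exists>n. (\<exists>as'. as = replicate n Alpha @ Beta # Alpha # as') \<and> ?f < stage_value (W n)))"
    unfolding ex_bounded_witness stage_value_less_iff f_less_1
    by (simp only: j fraction_less_iff)
  also have "\<dots> \<longleftrightarrow> set es \<subseteq> {(False, True)} \<and> ?f < mass (\<lambda>n. stage_value (W n)) as"
  proof -
    have "mass (\<lambda>n. stage_value (W n)) as = stage_value (W n)"
      if "as = replicate n Alpha @ Beta # Alpha # r" for n r
      using that by (simp add: mass_replicate)
    then show ?thesis
      by (cases rule: mass_cases[of as "\<lambda>n. stage_value (W n)"]) (metis, simp)
  qed
  also have "\<dots> \<longleftrightarrow> ?f < switching_env (\<lambda>n. stage_value (W n)) es as"
  proof -
    have "0 \<le> ?f" by (simp add: f)
    then show ?thesis by (auto simp: switching_env_def not_less)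
  qed
  finally show ?thesis .
qed

lemma decidable_below:
  assumes W: "decidable (\<lambda>e. W (e 0) (e (Suc 0)) (e (Suc (Suc 0))))"
  shows "decidable (\<lambda>e. below W (e 0) (e (Suc 0)) (e (Suc (Suc 0))) (e (Suc (Suc (Suc 0))))
    (e (Suc (Suc (Suc (Suc 0))))))"
proof -
  have W': "decidable (\<lambda>e. W (f e) (g e) (h e))" if "recursive f" "recursive g" "recursive h" for f g h
    using decidable_subst[OF W, of "case_nat f (case_nat g (\<lambda>_. h))"] that
    by (simp split: nat.split)
  show ?thesis unfolding below_def switch_code_def
    by (intro W' recursive_intros)
qed

lemma switching_env_lower_semicomputable:
  assumes W: "decidable (\<lambda>e. W (e 0) (e (Suc 0)) (e (Suc (Suc 0))))"
  shows "lower_semicomputable (switching_env (\<lambda>n. stage_value (W n)))"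
  unfolding lower_semicomputable_def
proof (rule rec_enumerableI)
  let ?\<nu> = "switching_env (\<lambda>n. stage_value (W n))"
  \<comment> \<open>Before \<open>below\<close> is consulted, the two lists must have equal length
    and consist of percept and action codes, so that no other numbers are enumerated.\<close>
  let ?P = "\<lambda>z s. length (list_decode (pfst z)) = length (list_decode (pfst (psnd z))) \<and>
    (\<forall>x\<in>set (list_decode (pfst z)). x = 0 \<or> x = 1 \<or> x = 2 \<or> x = 4) \<and>
    (\<forall>x\<in>set (list_decode (pfst (psnd z))). x = 0 \<or> x = 1) \<and>
    below W (pfst z) (pfst (psnd z)) (pfst (psnd (psnd z))) (psnd (psnd (psnd z))) s"
  have "decidable (\<lambda>e. below W (pfst (e (Suc 0))) (pfst (psnd (e (Suc 0)))) (pfst (psnd (psnd (e (Suc 0)))))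
      (psnd (psnd (psnd (e (Suc 0))))) (e 0))"
    using decidable_subst[OF decidable_below[OF W], of "case_nat (\<lambda>e. pfst (e (Suc 0)))
      (case_nat (\<lambda>e. pfst (psnd (e (Suc 0)))) (case_nat (\<lambda>e. pfst (psnd (psnd (e (Suc 0)))))
      (case_nat (\<lambda>e. psnd (psnd (psnd (e (Suc 0))))) (\<lambda>_ e. e 0))))"]
    by (simp add: recursive_intros split: nat.split)
  then show "decidable (\<lambda>e. ?P (e (Suc 0)) (e 0))"
    by (intro recursive_intros)
  fix z
  \<comment> \<open>The codings of pairs, lists and integers are onto, so every number has this
    shape.\<close>
  obtain E A i d where z: "z = prod_encode (list_encode E, prod_encode (list_encode A, fraction_code i d))"
    unfolding fraction_code_def
    by (metis prod_decode_inverse list_decode_inverse int_decode_inverse surj_pair)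
  have "(\<exists>s. ?P z s) \<longleftrightarrow> length E = length A \<and> set E \<subseteq> range percept_code \<and> set A \<subseteq> range action_code \<and>
      (\<exists>s. below W (list_encode E) (list_encode A) (int_encode i) d s)"
    unfolding range_percept_code range_action_code by (auto simp: z fraction_code_def)
  also have "\<dots> \<longleftrightarrow> (\<exists>es as. E = map percept_code es \<and> A = map action_code as \<and>
      length es = length as \<and> of_rat (fraction i d) < ?\<nu> es as)"
    unfolding mem_range_map[symmetric] below_iff[symmetric] by (auto 0 4)
  also have "\<dots> \<longleftrightarrow> z \<in> {prod_encode (list_encode (map percept_code es),
                       prod_encode (list_encode (map action_code as), fraction_code i d))
                     | es as i d. length es = length as \<and> of_rat (fraction i d) < ?\<nu> es as}"
    by (auto simp: z fraction_code_def list_encode_eq int_encode_eq)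
  finally show "z \<in> {prod_encode (list_encode (map percept_code es),
                       prod_encode (list_encode (map action_code as), fraction_code i d))
                     | es as i d. length es = length as \<and> of_rat (fraction i d) < ?\<nu> es as} \<longleftrightarrow>
      (\<exists>s. ?P z s)" by (rule sym)
qed

section \<open>The reduction\<close>

lemma inj_history_code: "inj history_code"
proof
  have "inj (\<lambda>(a, e). prod_encode (action_code a, percept_code e))"
    by (auto simp: inj_def inj_eq[OF inj_action_code] inj_eq[OF inj_percept_code])
  then show "h = h'" if "history_code h = history_code h'" for h h'
    using that by (simp add: history_code_def list_encode_eq inj_map_eq_map)
qed

lemma mem_policy_graph_iff: "prod_encode (history_code h, action_code a) \<in> policy_graph \<pi> \<longleftrightarrow> \<pi> h = a"
  using inj_history_code inj_action_code by (auto simp: policy_graph_def inj_eq)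

lemma recursive_decision_point:
  assumes "recursive f"
  shows "recursive (\<lambda>e. history_code (decision_point (f e)))"
proof -
  \<comment> \<open>Each entry pairs an action code with \<open>1\<close>, the code of the percept
    \<open>(False, True)\<close>.\<close>
  have "history_code (decision_point n) = list_encode (replicate n (prod_encode (0, 1)) @
      list_decode (list_encode [prod_encode (1, 1)]))" for n
    by (simp add: history_code_def decision_point_def map_replicate)
  then show ?thesis
    by (simp only:) (intro recursive_intros assms)
qed

theorem theorem6p16:
  fixes \<gamma> :: "nat \<Rightarrow> real"
  assumes "\<forall>k. \<gamma> k \<ge> 0"
    and "computable_real_seq \<gamma>"
    and "summable \<gamma>"
    and "\<forall>t. discount_tail \<gamma> t > 0"
  shows "\<exists>\<nu>. chronological_contextual_semimeasure \<nu> \<and> lower_semicomputable \<nu> \<and>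
           (\<forall>\<pi>. ainu \<gamma> \<nu> \<pi> \<longrightarrow> Pi02_hard (policy_graph \<pi>))"
proof -
  \<comment> \<open>\<open>W\<close> is fixed before any set \<open>A\<close> is given, since one
    environment has to serve all \<open>\<Pi>\<^sup>0\<^sub>2\<close> sets.\<close>
  obtain W where W: "decidable (\<lambda>e. W (e 0) (e (Suc 0)) (e (Suc (Suc 0))))"
    and universal: "\<And>R. decidable3 R \<Longrightarrow>
      \<exists>m. \<forall>n x. (\<exists>y. R n x y) \<longleftrightarrow> (\<exists>k. W (prod_encode (m, n)) x k)"
    using universal_decidable by blast
  let ?\<nu> = "switching_env (\<lambda>n. stage_value (W n))"
  have "Pi02_hard (policy_graph \<pi>)" if \<pi>: "ainu \<gamma> ?\<nu> \<pi>" for \<pi>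
    unfolding Pi02_hard_def
  proof (intro allI impI)
    fix A assume "Pi02 A"
    then obtain R where "decidable3 R" and A: "A = {n. \<forall>x. \<exists>y. R n x y}"
      unfolding Pi02_def by blast
    from universal[OF this(1)] obtain m where
      m: "\<And>n x. (\<exists>y. R n x y) \<longleftrightarrow> (\<exists>k. W (prod_encode (m, n)) x k)" by blast
    \<comment> \<open>With \<open>m\<close> hard-wired, \<open>n\<close> is sent to the question
      whether \<alpha> is taken at the decision point whose index codes the pair
      \<open>(m, n)\<close>.\<close>
    let ?f = "\<lambda>n. prod_encode (history_code (decision_point (prod_encode (m, n))), action_code Alpha)"
    have "computable ?f"
      by (intro computableI recursive_intros recursive_decision_point)
    moreover have "n \<in> A \<longleftrightarrow> ?f n \<in> policy_graph \<pi>" for n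
      unfolding mem_policy_graph_iff ainu_decision_point[OF assms(3) assms(4)[rule_format] \<pi>]
        stage_value_ge_1_iff A using m by simp
    ultimately show "many_one_reducible A (policy_graph \<pi>)"
      unfolding many_one_reducible_def by blast
  qed
  then show ?thesis
    using switching_env_semimeasure[OF stage_value_bounds] switching_env_lower_semicomputable[OF W]
    by blast
qed

end
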